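(* An $\mathbb N^*$-pair $(T,\mathcal J)$ is primitive if and only if it is a finite extension of an $\mathbb N$-pair through an extension process containing no illegal extension; that is, if and only if there exist $k\ge 0$ and a sequence $(T_0,\mathcal J_0),\dots,(T_k,\mathcal J_k)=(T,\mathcal J)$ of $\mathbb N^*$-pairs such that $(T_0,\mathcal J_0)$ is an $\mathbb N$-pair and, for each $1\le j\le k$, $(T_j,\mathcal J_j)$ is (up to a permutation of the coordinates) a first type or second type extension of $(T_{j-1},\mathcal J_{j-1})$ which is not an illegal extension.
   Context: $\mathbb N=\mathbb Z_{\ge 0}$. For $n\ge1$, an $\mathbb N^n$-pair is a pair $(T,\mathcal J)$ of subsets of $\mathbb N^n$ such that every element of $\mathbb N^n$ can be written in exactly one way as $t+s$ with $t\in T$, $s\in\mathcal J$. An $\mathbb N^*$-pair is an $\mathbb N^n$-pair for some $n\ge 1$. The Cartesian product of an $\mathbb N^p$-pair $(I_1,J_1)$ and an $\mathbb N^q$-pair $(I_2,J_2)$ ($p,q\ge1$) is the $\mathbb N^{p+q}$-pair $(I_1\times I_2,J_1\times J_2)$. An $\mathbb N^n$-pair is primitive if it is not, up to a simultaneous permutation of the $n$ coordinates of both sets, a Cartesian product of two $\mathbb N^*$-pairs of lower dimensions. In particular all $\mathbb N$-pairs are primitive. For $A\subset\mathbb N^n$ and variables $x=(x_1,\dots,x_n)$ put $A(x)=\sum_{a\in A}x^a$, where $x^a=x_1^{a_1}\cdots x_n^{a_n}$; a set is identified with this power series. Extensions. Let $(T,\mathcal J)$ be an $\mathbb N^n$-pair,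 $j\in\{1,\dots,n\}$, and write $x=(\bar x,x_j,\bar{\bar x})$ with $\bar x=(x_1,\dots,x_{j-1})$, $\bar{\bar x}=(x_{j+1},\dots,x_n)$. (1) First type: let $N\ge2$ and let $C,D\subset\{0,\dots,N-1\}$ be such that every element of $\{0,\dots,N-1\}$ is uniquely $c+d$ with $c\in C,d\in D$ and $C+D=\{0,\dots,N-1\}$. The $\mathbb N^n$-pair $(T^*,\mathcal J^* )$ given by $T^*(x)=C(x_j)T(\bar x,x_j^N,\bar{\bar x})$, $\mathcal J^*(x)=D(x_j)\mathcal J(\bar x,x_j^N,\bar{\bar x})$ is a first type extension of $(T,\mathcal J)$. (2) Second type: let $\delta\in\{0,1\}$, $m\ge2$, $\boldsymbol a=(a_1,\dots,a_m)\in(\mathbb N\setminus\{0\})^m$, $L_{\boldsymbol a}=\mathbb N^m\setminus(\mathbb N^m+\boldsymbol a)$, $y=(y_1,\dots,y_m)$, $y^{\boldsymbol a}=y_1^{a_1}\cdots y_m^{a_m}$. The $\mathbb N^{n+m-1}$-pair $(T^*,\mathcal J^* )$ given by $T^*(\bar x,y,\bar{\bar x})=L_{\boldsymbol a}(y)^{\delta}\,T(\bar x,y^{\boldsymbol a},\bar{\bar x})$, $\mathcal J^*(\bar x,y,\bar{\bar x})=L_{\boldsymbol a}(y)^{1-\delta}\,\mathcal J(\bar x,y^{\boldsymbol a},\bar{\bar x})$ is a second type extension of $(T,\mathcal J)$. An extension of $(T,\mathcal J)$ is illegal if it is a second type extension with $(T,\mathcal J)=(\{0\},\mathbb N)$ and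 $\delta=0$, or with $(T,\mathcal J)=(\mathbb N,\{0\})$ and $\delta=1$. *)

theory Defs
  imports Main "HOL-Combinatorics.Permutations"
begin

text \<open>
  Elements of \<open>\<nat>\<^sup>n\<close> are lists of naturals of length \<open>n\<close>; coordinates are numbered from \<open>0\<close>.
\<close>

definition vecs :: "nat \<Rightarrow> nat list set" where
  "vecs n = {v. length v = n}"

definition vadd :: "nat list \<Rightarrow> nat list \<Rightarrow> nat list" where
  "vadd u v = map2 (+) u v"

definition is_pair :: "nat \<Rightarrow> nat list set \<Rightarrow> nat list set \<Rightarrow> bool" where
  "is_pair n T J \<longleftrightarrow> n \<ge> 1 \<and> T \<subseteq> vecs n \<and> J \<subseteq> vecs n \<and>
     (\<forall>v\<in>vecs n. \<exists>!p. p \<in> T \<times> J \<and> vadd (fst p) (snd p) = v)"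

definition cart :: "nat list set \<Rightarrow> nat list set \<Rightarrow> nat list set" where
  "cart A B = {u @ v | u v. u \<in> A \<and> v \<in> B}"

definition permuted :: "nat \<Rightarrow> nat list set \<Rightarrow> nat list set \<Rightarrow> nat list set \<Rightarrow> nat list set \<Rightarrow> bool" where
  "permuted n T J T' J' \<longleftrightarrow>
     (\<exists>\<pi>. \<pi> permutes {..<n} \<and> T = permute_list \<pi> ` T' \<and> J = permute_list \<pi> ` J')"

definition primitive_pair :: "nat \<Rightarrow> nat list set \<Rightarrow> nat list set \<Rightarrow> bool" where
  "primitive_pair n T J \<longleftrightarrow> is_pair n T J \<and>
     \<not> (\<exists>p q I1 J1 I2 J2. n = p + q \<and> is_pair p I1 J1 \<and> is_pair q I2 J2 \<and>
          permuted n T J (cart I1 I2) (cart J1 J2))"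

text \<open>
  A formal power series in \<open>n\<close> variables is its coefficient function on exponent vectors,
  vanishing off \<open>vecs n\<close>. Coefficients in \<open>\<nat>\<close> suffice, as no subtraction occurs.
\<close>

type_synonym mseries = "nat list \<Rightarrow> nat"

definition series_of :: "nat list set \<Rightarrow> mseries" where
  "series_of A = (\<lambda>v. if v \<in> A then 1 else 0)"

definition ms_one :: "nat \<Rightarrow> mseries" where
  "ms_one n = series_of {replicate n 0}"

definition ms_mult :: "nat \<Rightarrow> mseries \<Rightarrow> mseries \<Rightarrow> mseries" where
  "ms_mult n f g = (\<lambda>v. \<Sum>(s, t) \<in> {(s, t). s \<in> vecs n \<and> t \<in> vecs n \<and> vadd s t = v}. f s * g t)"

definition ms_power :: "nat \<Rightarrow> mseries \<Rightarrow> nat \<Rightarrow> mseries" where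
  "ms_power n f k = (ms_mult n f ^^ k) (ms_one n)"

text \<open>
  Substitution of monomials for the \<open>n\<close> variables of a series: \<open>\<phi>\<close> is the induced map on
  exponent vectors, i.e. \<open>x\<^sup>v\<close> becomes the monomial with exponent \<open>\<phi> v\<close>. The sum is
  meaningful when \<open>\<phi>\<close> has finite fibres on \<open>vecs n\<close>; below \<open>\<phi>\<close> is always injective there.
\<close>

definition ms_subst :: "nat \<Rightarrow> (nat list \<Rightarrow> nat list) \<Rightarrow> mseries \<Rightarrow> mseries" where
  "ms_subst n \<phi> f = (\<lambda>w. \<Sum>v \<in> {v \<in> vecs n. \<phi> v = w}. f v)"

text \<open>\<open>f(x\<^sub>j,\<dots>,x\<^sub>j\<^sub>+\<^sub>m\<^sub>-\<^sub>1)\<close> as a series in \<open>n\<close> variables, for \<open>f\<close> in \<open>m\<close> variables.\<close>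

definition in_vars :: "nat \<Rightarrow> nat \<Rightarrow> nat \<Rightarrow> mseries \<Rightarrow> mseries" where
  "in_vars n j m = ms_subst m (\<lambda>v. replicate j 0 @ v @ replicate (n - j - m) 0)"

text \<open>
  \<open>f\<close> with \<open>x\<^sub>j\<close> replaced by \<open>y\<^sub>1\<^bsup>a\<^sub>1\<^esup> \<dots> y\<^sub>m\<^bsup>a\<^sub>m\<^esup>\<close>, where the new variables \<open>y\<close> take the place of \<open>x\<^sub>j\<close>.
  The case \<open>a = [N]\<close> is the substitution of \<open>x\<^sub>j\<^sup>N\<close> for \<open>x\<^sub>j\<close>.
\<close>

definition subst_var :: "nat \<Rightarrow> nat \<Rightarrow> nat list \<Rightarrow> mseries \<Rightarrow> mseries" where
  "subst_var n j a = ms_subst n (\<lambda>v. take j v @ map (\<lambda>c. v ! j * c) a @ drop (Suc j) v)"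

definition first_type_ext ::
  "nat \<Rightarrow> nat list set \<Rightarrow> nat list set \<Rightarrow> nat \<Rightarrow> nat list set \<Rightarrow> nat list set \<Rightarrow> bool" where
  "first_type_ext n T J n' T' J' \<longleftrightarrow> is_pair n T J \<and> n' = n \<and>
     (\<exists>j N C D. j < n \<and> N \<ge> 2 \<and> C \<subseteq> {0..<N} \<and> D \<subseteq> {0..<N} \<and>
        (\<forall>k\<in>{0..<N}. \<exists>!p. p \<in> C \<times> D \<and> fst p + snd p = k) \<and>
        {c + d | c d. c \<in> C \<and> d \<in> D} = {0..<N} \<and>
        series_of T' = ms_mult n' (in_vars n' j 1 (series_of ((\<lambda>c. [c]) ` C)))
                                  (subst_var n j [N] (series_of T)) \<and>
        series_of J' = ms_mult n' (in_vars n' j 1 (series_of ((\<lambda>d. [d]) ` D)))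
                                  (subst_var n j [N] (series_of J)))"

definition L_set :: "nat list \<Rightarrow> nat list set" where
  "L_set a = vecs (length a) - (\<lambda>v. vadd v a) ` vecs (length a)"

definition second_type_ext ::
  "nat \<Rightarrow> nat \<Rightarrow> nat list set \<Rightarrow> nat list set \<Rightarrow> nat \<Rightarrow> nat list set \<Rightarrow> nat list set \<Rightarrow> bool" where
  "second_type_ext \<delta> n T J n' T' J' \<longleftrightarrow> is_pair n T J \<and> \<delta> \<in> {0, 1} \<and>
     (\<exists>j m a. j < n \<and> m \<ge> 2 \<and> length a = m \<and> (\<forall>c\<in>set a. c \<noteq> 0) \<and> n' = n + m - 1 \<and>
        series_of T' = ms_mult n' (ms_power n' (in_vars n' j m (series_of (L_set a))) \<delta>)
                                  (subst_var n j a (series_of T)) \<and>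
        series_of J' = ms_mult n' (ms_power n' (in_vars n' j m (series_of (L_set a))) (1 - \<delta>))
                                  (subst_var n j a (series_of J)))"

definition extension ::
  "nat \<Rightarrow> nat list set \<Rightarrow> nat list set \<Rightarrow> nat \<Rightarrow> nat list set \<Rightarrow> nat list set \<Rightarrow> bool" where
  "extension n T J n' T' J' \<longleftrightarrow>
     first_type_ext n T J n' T' J' \<or> (\<exists>\<delta>. second_type_ext \<delta> n T J n' T' J')"

definition illegal_ext ::
  "nat \<Rightarrow> nat list set \<Rightarrow> nat list set \<Rightarrow> nat \<Rightarrow> nat list set \<Rightarrow> nat list set \<Rightarrow> bool" where
  "illegal_ext n T J n' T' J' \<longleftrightarrow>
     (second_type_ext 0 n T J n' T' J' \<and> n = 1 \<and> T = {[0]} \<and> J = vecs 1) \<or>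
     (second_type_ext 1 n T J n' T' J' \<and> n = 1 \<and> T = vecs 1 \<and> J = {[0]})"

definition legal_step ::
  "nat \<Rightarrow> nat list set \<Rightarrow> nat list set \<Rightarrow> nat \<Rightarrow> nat list set \<Rightarrow> nat list set \<Rightarrow> bool" where
  "legal_step n T J n' T' J' \<longleftrightarrow>
     (\<exists>T'' J''. permuted n' T' J' T'' J'' \<and>
        extension n T J n' T'' J'' \<and> \<not> illegal_ext n T J n' T'' J'')"

end

theory Submission
  imports Defs "HOL-Library.Function_Algebras"
begin

text \<open>
  A pair is a Cartesian product up to a permutation of coordinates iff for some proper nonempty set
  \<open>S\<close> of coordinates both sets are closed under the projections to \<open>S\<close> and to its complement
  (\<open>splits\<close>). A block extension carries a non-splitting pair to a non-splitting pair: a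
  splitting either respects the new block and descends, or cuts it, and then the smaller pair
  splits unless the extension is illegal.

  Conversely, two distinct minimal nonzero elements of \<open>J\<close> have disjoint supports, since otherwise
  their join has two representations. If \<open>s \<in> J\<close> is minimal nonzero with support \<open>K\<close>, then
  \<open>(T, J)\<close> is an extension along the block \<open>K\<close> with exponents \<open>s\<close>: by induction, \<open>T\<close> is a
  union of translates of \<open>L\<close> and \<open>J\<close> is supported on the multiples of \<open>s\<close> in \<open>K\<close>. This is a second
  type extension if \<open>K\<close> has at least two elements and a first type extension otherwise. If all
  minimal nonzero elements of \<open>T\<close> and \<open>J\<close> are unit vectors, both sets are coordinate faces, so a
  primitive pair is one-dimensional. Repeated reduction terminates, because first type
  reductions lower the smallest coordinates at which the pair fails to split off an axis.
\<close>

section \<open>Pairs of sets of finitely supported functions\<close>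

text \<open>A splitting speaks of closure under two projections only, so a pair and its extension
  can be compared without naming any factors. Lists are replaced by functions vanishing off an index
  set: a permutation of coordinates becomes composition with that permutation, and faces of all
  dimensions live in one type. Exchanging \<open>T\<close> and \<open>J\<close> turns
  \<open>\<delta> = 0\<close> into \<open>\<delta> = 1\<close>, so only the case where
  \<open>T\<close> gets the factor \<open>L\<close> and \<open>J\<close> is merely stretched is
  studied. The excluded pair is a true exception there: if \<open>T\<close> is everything and
  \<open>J = {0}\<close> in dimension one, the same holds for the extension in dimension at least
  two, and it splits along every set. In the converse direction legality is automatic, because an
  illegal extension has a component \<open>{0}\<close> and a primitive pair with such a component is
  one-dimensional. The delicate point is termination: a first type reduction keeps the dimension,
  and the sets may be infinite, so neither dimension nor cardinality alone measures
  progress.\<close>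

definition vectors :: "'a set \<Rightarrow> ('a \<Rightarrow> nat) set" where
  "vectors I = {v. \<forall>i. i \<notin> I \<longrightarrow> v i = 0}"

definition restr :: "'a set \<Rightarrow> ('a \<Rightarrow> nat) \<Rightarrow> 'a \<Rightarrow> nat" where
  "restr S v = (\<lambda>i. if i \<in> S then v i else 0)"

definition fpair :: "'a set \<Rightarrow> ('a \<Rightarrow> nat) set \<Rightarrow> ('a \<Rightarrow> nat) set \<Rightarrow> bool" where
  "fpair I T J \<longleftrightarrow> T \<subseteq> vectors I \<and> J \<subseteq> vectors I \<and>
     (\<forall>v\<in>vectors I. \<exists>!p. p \<in> T \<times> J \<and> fst p + snd p = v)"

text \<open>Complements are taken in the whole index type, which is harmless because all vectors
  vanish off \<open>I\<close>. Only closure under projections is asked for; that projections of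
  different elements may be added again is \<open>splits_recombine\<close>.\<close>

definition splits :: "'a set \<Rightarrow> ('a \<Rightarrow> nat) set \<Rightarrow> ('a \<Rightarrow> nat) set \<Rightarrow> bool" where
  "splits S T J \<longleftrightarrow> (\<forall>t\<in>T. restr S t \<in> T \<and> restr (- S) t \<in> T) \<and>
     (\<forall>s\<in>J. restr S s \<in> J \<and> restr (- S) s \<in> J)"

definition fprim :: "'a set \<Rightarrow> ('a \<Rightarrow> nat) set \<Rightarrow> ('a \<Rightarrow> nat) set \<Rightarrow> bool" where
  "fprim I T J \<longleftrightarrow> fpair I T J \<and> (\<forall>S. S \<subseteq> I \<longrightarrow> S \<noteq> {} \<longrightarrow> S \<noteq> I \<longrightarrow> \<not> splits S T J)"

lemma vectorsI: "(\<And>i. i \<notin> I \<Longrightarrow> v i = 0) \<Longrightarrow> v \<in> vectors I"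
  by (simp add: vectors_def)

lemma vectorsD: "v \<in> vectors I \<Longrightarrow> i \<notin> I \<Longrightarrow> v i = 0"
  by (simp add: vectors_def)

lemma vectors_add_iff [simp]: "u + v \<in> vectors I \<longleftrightarrow> u \<in> vectors I \<and> v \<in> vectors I"
  by (auto simp: vectors_def)

lemma zero_in_vectors [simp]: "0 \<in> vectors I"
  by (simp add: vectors_def)

lemma vectors_mono: "S \<subseteq> I \<Longrightarrow> v \<in> vectors S \<Longrightarrow> v \<in> vectors I"
  by (auto simp: vectors_def)

lemma vectors_le: "v \<in> vectors I \<Longrightarrow> u \<le> v \<Longrightarrow> u \<in> vectors I"
  by (metis le_fun_def le_zero_eq vectorsD vectorsI)

lemma vectors_nonzero_obtain:
  assumes "v \<in> vectors I" "v \<noteq> 0"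
  obtains i where "i \<in> I" "v i > 0"
proof -
  obtain i where "v i > 0" using assms(2) by (auto simp: fun_eq_iff)
  then show ?thesis using that[of i] vectorsD[OF assms(1), of i] by (cases "i \<in> I") auto
qed

lemma add_fun_eq_0_iff [simp]: "u + v = 0 \<longleftrightarrow> u = 0 \<and> v = 0" for u v :: "'a \<Rightarrow> nat"
  by (auto simp: fun_eq_iff)

lemma add_fun_le: "u \<le> u + v" "v \<le> u + v" for u v :: "'a \<Rightarrow> nat"
  by (auto simp: le_fun_def)

lemma fun_diff_add: "u \<le> v \<Longrightarrow> u + (v - u) = v" for u v :: "'a \<Rightarrow> nat"
  by (auto simp: le_fun_def fun_eq_iff)

lemma restr_in_vectors: "v \<in> vectors I \<Longrightarrow> restr S v \<in> vectors I"
  by (auto simp: vectors_def restr_def)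

lemma restr_in_vectors_self [simp]: "restr S v \<in> vectors S"
  by (auto simp: vectors_def restr_def)

lemma restr_compl_split: "restr S v + restr (- S) v = v"
  by (auto simp: restr_def)

lemma restr_eq: "v \<in> vectors S \<Longrightarrow> restr S v = v"
  by (auto simp: restr_def vectors_def)

lemma restr_eq_0: "v \<in> vectors S \<Longrightarrow> S \<inter> R = {} \<Longrightarrow> restr R v = 0"
  by (auto simp: restr_def vectors_def fun_eq_iff)

lemma restr_add: "restr S (u + v) = restr S u + restr S v"
  by (auto simp: restr_def)

lemma restr_0 [simp]: "restr S 0 = 0"
  by (auto simp: restr_def)

lemma fpairI:
  assumes "T \<subseteq> vectors I" "J \<subseteq> vectors I"
    and "\<And>v. v \<in> vectors I \<Longrightarrow> \<exists>t\<in>T. \<exists>s\<in>J. v = t + s"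
    and "\<And>t s t' s'. \<lbrakk>t \<in> T; s \<in> J; t' \<in> T; s' \<in> J; t + s = t' + s'\<rbrakk> \<Longrightarrow> t = t' \<and> s = s'"
  shows "fpair I T J"
  unfolding fpair_def
proof (intro conjI ballI)
  fix v assume "v \<in> vectors I"
  then obtain t s where "t \<in> T" "s \<in> J" "v = t + s" using assms(3) by blast
  then show "\<exists>!p. p \<in> T \<times> J \<and> fst p + snd p = v"
    using assms(4)[of _ _ t s] by (intro ex1I[of _ "(t, s)"]) (auto simp del: plus_fun_apply)
qed (use assms in auto)

lemma fpair_subset:
  assumes "fpair I T J"
  shows "T \<subseteq> vectors I" "J \<subseteq> vectors I"
  using assms by (auto simp: fpair_def)

lemma fpair_obtain:
  assumes "fpair I T J" "v \<in> vectors I"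
  obtains t s where "t \<in> T" "s \<in> J" "v = t + s"
proof -
  have "\<exists>!p. p \<in> T \<times> J \<and> fst p + snd p = v" using assms unfolding fpair_def by blast
  then show ?thesis using that by (metis mem_Times_iff)
qed

lemma fpair_unique:
  assumes "fpair I T J" "t \<in> T" "s \<in> J" "t' \<in> T" "s' \<in> J" "t + s = t' + s'"
  shows "t = t'" "s = s'"
proof -
  have "t + s \<in> vectors I" using assms fpair_subset[of I T J] by auto
  then have "\<exists>!p. p \<in> T \<times> J \<and> fst p + snd p = t + s" using assms(1) by (simp add: fpair_def)
  then obtain q where "\<And>p. p \<in> T \<times> J \<Longrightarrow> fst p + snd p = t + s \<Longrightarrow> p = q"
    by (metis (no_types, lifting))
  from this[of "(t, s)"] this[of "(t', s')"] have "(t, s) = (t', s')"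
    using assms(2-6) by simp
  then show "t = t'" "s = s'" by auto
qed

lemma fpair_swap:
  assumes "fpair I T J"
  shows "fpair I J T"
proof (rule fpairI)
  fix v assume "v \<in> vectors I"
  then show "\<exists>t\<in>J. \<exists>s\<in>T. v = t + s"
    using fpair_obtain[OF assms] by (metis add.commute)
next
  fix t s t' s'
  assume "t \<in> J" "s \<in> T" "t' \<in> J" "s' \<in> T" "t + s = t' + s'"
  then show "t = t' \<and> s = s'"
    using fpair_unique[OF assms, of s t s' t'] by (simp add: add.commute)
qed (use fpair_subset[OF assms] in auto)

lemma fpair_zero:
  assumes "fpair I T J"
  shows "0 \<in> T" "0 \<in> J"
  by (metis add_fun_eq_0_iff assms fpair_obtain zero_in_vectors)+

lemma fpair_inter:
  assumes "fpair I T J" "v \<in> T" "v \<in> J"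
  shows "v = 0"
  using fpair_unique[of I T J v 0 0 v] assms fpair_zero[of I T J] by auto

text \<open>\<open>t + s\<close> has the representations \<open>(t + s, 0)\<close> and
  \<open>(t, s)\<close>. Many contradictions below come from this.\<close>

lemma fpair_left_of_sum:
  assumes "fpair I T J" "t + s \<in> T" "t \<in> T" "s \<in> J"
  shows "s = 0"
  using fpair_unique[of I T J "t + s" 0 t s] assms fpair_zero[of I T J] by auto

lemma splits_swap: "splits S T J \<longleftrightarrow> splits S J T"
  by (auto simp: splits_def)

lemma restr_diff_compl: "v \<in> vectors I \<Longrightarrow> restr (I - S) v = restr (- S) v"
  "v \<in> vectors I \<Longrightarrow> restr (- (I - S)) v = restr S v"
  by (auto simp: restr_def vectors_def fun_eq_iff)

lemma splits_diff:
  assumes "fpair I T J"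
  shows "splits (I - S) T J \<longleftrightarrow> splits S T J"
proof -
  have "restr (I - S) v = restr (- S) v" "restr (- (I - S)) v = restr S v" if "v \<in> T \<union> J" for v
    using that fpair_subset[OF assms] restr_diff_compl by blast+
  then show ?thesis by (auto simp: splits_def)
qed

lemma fprim_swap: "fprim I T J \<Longrightarrow> fprim I J T"
  unfolding fprim_def using fpair_swap splits_swap by metis

lemma fprim_fpair: "fprim I T J \<Longrightarrow> fpair I T J"
  by (simp add: fprim_def)

text \<open>Write \<open>u + v = t + s\<close>. Restricting to \<open>S\<close> gives
  \<open>u\<close> as the sum of the projections of \<open>t\<close> and \<open>s\<close>, which lie
  in \<open>T\<close> and \<open>J\<close>; as \<open>u\<close> is in \<open>T\<close>, the
  projection of \<open>s\<close> is 0. The same argument on the complement gives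
  \<open>s = 0\<close>.\<close>

lemma splits_recombine:
  assumes pair: "fpair I T J" and sp: "splits S T J"
    and u: "u \<in> T" "u \<in> vectors S" and v: "v \<in> T" "v \<in> vectors (- S)"
  shows "u + v \<in> T"
proof -
  have "u + v \<in> vectors I" using u v fpair_subset[OF pair] by auto
  then obtain t s where ts: "t \<in> T" "s \<in> J" "u + v = t + s" using fpair_obtain pair by metis
  have "restr S t \<in> T" "restr (- S) t \<in> T" "restr S s \<in> J" "restr (- S) s \<in> J"
    using sp ts by (auto simp: splits_def)
  moreover have "u = restr S t + restr S s"
    using arg_cong[OF ts(3), of "restr S"] u v restr_eq_0[of v "- S" S]
    by (simp add: restr_add restr_eq)
  moreover have "v = restr (- S) t + restr (- S) s"
    using arg_cong[OF ts(3), of "restr (- S)"] u v restr_eq_0[of u "S" "- S"]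
    by (simp add: restr_add restr_eq)
  ultimately have "restr S s = 0" "restr (- S) s = 0"
    using fpair_left_of_sum[OF pair] u(1) v(1) by metis+
  then have "s = 0" using restr_compl_split[of S s] by auto
  then show ?thesis using ts by simp
qed

section \<open>Extensions along a block of coordinates\<close>

text \<open>The coordinates in the block \<open>K\<close> all come from the coordinate \<open>j\<close>. Both types of extension
  have this form, with \<open>K\<close> a singleton for the first type; since \<open>p\<close> is any injection off \<open>K\<close>,
  permutations of the coordinates are covered as well.\<close>

locale stretching =
  fixes I :: "'b set" and I' :: "'a set" and p :: "'a \<Rightarrow> 'b" and A :: "'a \<Rightarrow> nat"
    and j :: 'b and K :: "'a set"
  assumes finite_big: "finite I'"
    and image_p: "p ` I' = I"
    and K_def: "K = {i \<in> I'. p i = j}"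
    and j_in: "j \<in> I"
    and inj_p: "inj_on p (I' - K)"
    and A_pos: "\<And>i. i \<in> I' \<Longrightarrow> A i > 0"
    and A_one: "\<And>i. i \<in> I' - K \<Longrightarrow> A i = 1"
begin

text \<open>The exponent map of the substitution that replaces the variable \<open>j\<close> by a
  monomial in the variables of \<open>K\<close> with exponents \<open>A\<close> and renames all
  other variables.\<close>

definition stretch :: "('b \<Rightarrow> nat) \<Rightarrow> 'a \<Rightarrow> nat" where
  "stretch t = (\<lambda>i. if i \<in> I' then A i * t (p i) else 0)"

text \<open>This is \<open>L_a\<close> on the face of \<open>K\<close>: lying outside the translate
  by \<open>A\<close> means failing to dominate \<open>A\<close> at some coordinate of
  \<open>K\<close>. It serves as the set of remainders modulo \<open>A\<close>.\<close>

definition L :: "('a \<Rightarrow> nat) set" where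
  "L = {l \<in> vectors K. \<exists>i\<in>K. l i < A i}"

lemma K_subset: "K \<subseteq> I'" and K_nonempty: "K \<noteq> {}" and finite_K: "finite K"
  using K_def image_p j_in finite_big by auto

lemma stretch_K: "i \<in> K \<Longrightarrow> stretch t i = A i * t j"
  using K_def by (auto simp: stretch_def)

lemma stretch_off_K: "i \<in> I' - K \<Longrightarrow> stretch t i = t (p i)"
  using A_one by (auto simp: stretch_def)

lemma stretch_in_vectors [simp]: "stretch t \<in> vectors I'"
  by (auto simp: stretch_def vectors_def)

lemma stretch_add: "stretch (u + v) = stretch u + stretch v"
  by (auto simp: stretch_def fun_eq_iff algebra_simps)

lemma stretch_0 [simp]: "stretch 0 = 0"
  by (auto simp: stretch_def fun_eq_iff)

lemma stretch_restr: "stretch (restr S t) = restr (p -` S) (stretch t)"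
  by (auto simp: stretch_def restr_def fun_eq_iff)

lemma stretch_inj:
  assumes "u \<in> vectors I" "v \<in> vectors I" "stretch u = stretch v"
  shows "u = v"
proof
  fix i show "u i = v i"
  proof (cases "i \<in> I")
    case True
    then obtain k where k: "k \<in> I'" "p k = i" using image_p by auto
    have "stretch u k = stretch v k" using assms by simp
    then show ?thesis using k A_pos[of k] by (simp add: stretch_def)
  qed (use assms vectorsD in metis)
qed

lemma zero_in_L: "0 \<in> L"
  using K_nonempty A_pos K_subset by (auto simp: L_def)

lemma L_in_vectors: "l \<in> L \<Longrightarrow> l \<in> vectors I'"
  using vectors_mono[OF K_subset] by (auto simp: L_def)

lemma L_le: "l \<in> L \<Longrightarrow> l' \<le> l \<Longrightarrow> l' \<in> L"
  using vectors_le unfolding L_def le_fun_def by (fastforce intro: le_less_trans)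

text \<open>Uniqueness in division with remainder by \<open>A\<close> on the block. At a coordinate
  where the remainder is below \<open>A i\<close>, the quotient on that side is at least the other
  one; using this for both sides makes the quotients at \<open>j\<close> equal.\<close>

lemma L_stretch_unique:
  assumes "l \<in> L" "l' \<in> L" "u \<in> vectors I" "v \<in> vectors I" "l + stretch u = l' + stretch v"
  shows "l = l'" "u = v"
proof -
  have le: "y j \<le> x j"
    if h: "k \<in> L" "k + stretch x = k' + stretch y" for k k' x y
  proof -
    obtain i where i: "i \<in> K" "k i < A i" using h by (auto simp: L_def)
    have "k i + A i * x j = k' i + A i * y j"
      using fun_cong[OF h(2), of i] i stretch_K by simp
    then have "A i * y j < A i * Suc (x j)" using i(2) by simp
    then show ?thesis by (meson less_Suc_eq_le mult_less_cancel1)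
  qed
  have "u j = v j" using le[of l u l' v] le[of l' v l u] assms by auto
  then have eqK: "stretch u i = stretch v i" if "i \<in> K" for i using that stretch_K by simp
  show "l = l'"
  proof
    fix i
    show "l i = l' i"
    proof (cases "i \<in> K")
      case True
      then show ?thesis using fun_cong[OF assms(5), of i] eqK by simp
    qed (use assms(1,2) in \<open>auto simp: L_def vectors_def\<close>)
  qed
  then show "u = v" using stretch_inj assms by simp
qed

lemma stretch_unique:
  assumes "l \<in> L" "u \<in> vectors I" "v \<in> vectors I" "l + stretch u = stretch v"
  shows "l = 0" "u = v"
  using L_stretch_unique[of l 0 u v] assms zero_in_L by auto

text \<open>Existence in division with remainder. The quotient at \<open>j\<close> is the minimum of
  \<open>v i div A i\<close> over \<open>K\<close>; a coordinate attaining the minimum leaves a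
  remainder below \<open>A i\<close>, which is membership in \<open>L\<close>.\<close>

lemma L_stretch_obtain:
  assumes "v \<in> vectors I'"
  obtains l b where "l \<in> L" "b \<in> vectors I" "v = l + stretch b"
proof -
  define k where "k = Min ((\<lambda>i. v i div A i) ` K)"
  have le: "A i * k \<le> v i" if "i \<in> K" for i
  proof -
    have "k \<le> v i div A i" unfolding k_def using that finite_K by auto
    then have "k * A i \<le> (v i div A i) * A i" by simp
    also have "\<dots> \<le> v i" by simp
    finally show ?thesis by (simp add: mult.commute)
  qed
  have "k \<in> (\<lambda>i. v i div A i) ` K" unfolding k_def using finite_K K_nonempty by auto
  then obtain i0 where i0: "i0 \<in> K" "k = v i0 div A i0" by auto
  \<comment> \<open>Off the block \<open>p\<close> is injective, so the entries of \<open>v\<close>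
    there are copied back along its inverse.\<close>
  define b where "b = (\<lambda>i. if i \<in> I then if i = j then k else v (inv_into (I' - K) p i) else 0)"
  have b: "b \<in> vectors I" by (auto simp: b_def vectors_def)
  have bK: "stretch b i = A i * k" if "i \<in> K" for i
    using that stretch_K j_in by (simp add: b_def)
  have boff: "stretch b i = v i" if "i \<notin> K" for i
  proof (cases "i \<in> I'")
    case True
    then have "p i \<noteq> j" "p i \<in> I" using that K_def image_p by auto
    moreover have "inv_into (I' - K) p (p i) = i" using inj_p True that by simp
    ultimately show ?thesis using stretch_off_K True that by (simp add: b_def)
  next
    case False
    then show ?thesis using assms by (auto simp: stretch_def vectors_def)
  qed
  have ble: "stretch b \<le> v" using le bK boff by (metis le_fun_def order_refl)
  define l where "l = v - stretch b"
  have "v i0 - A i0 * (v i0 div A i0) < A i0"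
    using A_pos i0 K_subset by (metis minus_mult_div_eq_mod mod_less_divisor subsetD)
  then have "l i0 < A i0" using bK i0 by (simp add: l_def)
  moreover have "l \<in> vectors K" using boff by (auto simp: l_def vectors_def)
  ultimately have "l \<in> L" using i0 by (auto simp: L_def)
  moreover have "v = l + stretch b" using fun_diff_add[OF ble] by (simp add: l_def add.commute)
  ultimately show ?thesis using b that by blast
qed

end

section \<open>Splittings of an extension and of the pair it comes from\<close>

context stretching
begin

definition extend :: "('a \<Rightarrow> nat) set \<Rightarrow> ('b \<Rightarrow> nat) set \<Rightarrow> ('a \<Rightarrow> nat) set" where
  "extend C T = {c + stretch t | c t. c \<in> C \<and> t \<in> T}"

lemma extend_zero: "extend {0} T = stretch ` T"
  by (auto simp: extend_def)

lemma stretch_in_extend_iff: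
  assumes "C \<subseteq> L" "0 \<in> C" "T \<subseteq> vectors I" "t \<in> vectors I"
  shows "stretch t \<in> extend C T \<longleftrightarrow> t \<in> T"
proof
  assume "stretch t \<in> extend C T"
  then obtain c u where "c \<in> C" "u \<in> T" "c + stretch u = stretch t"
    by (auto simp: extend_def)
  then show "t \<in> T" using stretch_unique[of c u t] assms by auto
next
  assume "t \<in> T"
  then show "stretch t \<in> extend C T"
    using assms(2) by (force simp: extend_def)
qed

text \<open>A set \<open>S\<close> that does not cut the block is the full preimage, within
  \<open>I'\<close>, of its image under \<open>p\<close>.\<close>

lemma stretch_restr_image:
  assumes "S \<subseteq> I'" "K \<subseteq> S \<or> K \<inter> S = {}"
  shows "stretch (restr (p ` S) t) = restr S (stretch t)"
    and "stretch (restr (- p ` S) t) = restr (- S) (stretch t)"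
proof -
  have "i \<in> S" if i: "i \<in> I'" "p i \<in> p ` S" for i
  proof -
    obtain k where k: "k \<in> S" "p i = p k" using i by auto
    then show ?thesis using i assms K_def inj_onD[OF inj_p, of i k] by (cases "p i = j") auto
  qed
  then have "i \<in> S \<longleftrightarrow> p i \<in> p ` S" if "i \<in> I'" for i using that by auto
  then show "stretch (restr (p ` S) t) = restr S (stretch t)"
    "stretch (restr (- p ` S) t) = restr (- S) (stretch t)"
    by (auto simp: stretch_def restr_def fun_eq_iff)
qed

text \<open>\<open>stretch t\<close> lies in an extension exactly when \<open>t\<close> lies in the
  original set, so closure under projections can be tested after stretching.\<close>

lemma splits_extend_uncut:
  assumes "C \<subseteq> L" "0 \<in> C" "D \<subseteq> L" "0 \<in> D" "T \<subseteq> vectors I" "J \<subseteq> vectors I"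
    and S: "S \<subseteq> I'" "K \<subseteq> S \<or> K \<inter> S = {}"
    and sp: "splits S (extend C T) (extend D J)"
  shows "splits (p ` S) T J"
proof -
  have *: "restr (p ` S) t \<in> U \<and> restr (- p ` S) t \<in> U"
    if "t \<in> U" "U \<subseteq> vectors I" "E \<subseteq> L" "0 \<in> E"
      "\<forall>t\<in>extend E U. restr S t \<in> extend E U \<and> restr (- S) t \<in> extend E U" for t E U
  proof -
    have t: "t \<in> vectors I" using that by auto
    have "stretch t \<in> extend E U" using stretch_in_extend_iff[of E U t] that t by auto
    then have "stretch (restr (p ` S) t) \<in> extend E U" "stretch (restr (- p ` S) t) \<in> extend E U"
      using that(5) stretch_restr_image[OF S] by auto
    then show ?thesis
      using stretch_in_extend_iff[of E U] that(2-4) restr_in_vectors[OF t] by simp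
  qed
  have "\<forall>t\<in>extend C T. restr S t \<in> extend C T \<and> restr (- S) t \<in> extend C T"
    "\<forall>t\<in>extend D J. restr S t \<in> extend D J \<and> restr (- S) t \<in> extend D J"
    using sp by (simp_all add: splits_def)
  then show ?thesis
    using *[OF _ assms(5,1,2)] *[OF _ assms(6,3,4)] by (simp add: splits_def)
qed

lemma image_proper:
  assumes "S \<subseteq> I'" "K \<subseteq> S \<or> K \<inter> S = {}" "S \<noteq> I'"
  shows "p ` S \<noteq> I"
proof
  assume "p ` S = I"
  obtain i where i: "i \<in> I'" "i \<notin> S" using assms by auto
  then have "p i \<in> p ` S" using \<open>p ` S = I\<close> image_p by auto
  then obtain k where k: "k \<in> S" "p i = p k" by auto
  then show False using i assms K_def inj_onD[OF inj_p, of i k] by (cases "p i = j") auto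
qed

lemma fprim_extend_uncut:
  assumes "C \<subseteq> L" "0 \<in> C" "D \<subseteq> L" "0 \<in> D" and prim: "fprim I T J"
    and S: "S \<subseteq> I'" "K \<subseteq> S \<or> K \<inter> S = {}" "S \<noteq> {}" "S \<noteq> I'"
  shows "\<not> splits S (extend C T) (extend D J)"
proof
  assume "splits S (extend C T) (extend D J)"
  then have "splits (p ` S) T J"
    using splits_extend_uncut assms fpair_subset[OF fprim_fpair[OF prim]] by blast
  moreover have "p ` S \<subseteq> I" "p ` S \<noteq> {}" "p ` S \<noteq> I" using S image_p image_proper by auto
  ultimately show False using prim by (auto simp: fprim_def)
qed

text \<open>A splitting that cuts the block \<open>K\<close> forces \<open>J\<close> to vanish at \<open>j\<close>; then the whole face
  of \<open>K\<close> lies in \<open>extend L T\<close>, and the splitting can be moved off the block.\<close>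

lemma splits_extend_cut:
  assumes pair: "fpair I T J" and pair': "fpair I' (extend L T) (stretch ` J)"
    and S: "S \<subseteq> I'" and i1: "i1 \<in> K \<inter> S" and i2: "i2 \<in> K - S"
    and sp: "splits S (extend L T) (stretch ` J)"
  shows "\<forall>s\<in>J. s j = 0" "vectors K \<subseteq> extend L T" "splits (p ` (S - K)) T J"
proof -
  note TV = fpair_subset[OF pair]
  show J0: "\<forall>s\<in>J. s j = 0"
  proof
    fix s assume "s \<in> J"
    then obtain s' where s': "s' \<in> J" "restr S (stretch s) = stretch s'"
      using sp by (auto simp: splits_def)
    \<comment> \<open>At \<open>i2\<close>, outside \<open>S\<close>, the projection is 0, so
      \<open>s'\<close> vanishes at \<open>j\<close>. At \<open>i1\<close>, inside \<open>S\<close>,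
      the projection keeps the entry \<open>A i1 * s j\<close>, which is therefore 0 too.\<close>
    have "A i2 * s' j = 0" using fun_cong[OF s'(2), of i2] i2 stretch_K by (simp add: restr_def)
    then have "s' j = 0" using A_pos i2 K_subset by (metis DiffD1 mult_is_0 not_gr0 subsetD)
    then have "A i1 * s j = 0" using fun_cong[OF s'(2), of i1] i1 stretch_K by (simp add: restr_def)
    then show "s j = 0" using A_pos i1 K_subset by (metis IntD1 mult_is_0 not_gr0 subsetD)
  qed
  have stretch_J: "stretch s i = 0" if "s \<in> J" "i \<in> K" for s i
    using that J0 stretch_K by simp
  show face: "vectors K \<subseteq> extend L T"
  proof
    fix v assume v: "v \<in> vectors K"
    then obtain t s where ts: "t \<in> extend L T" "s \<in> stretch ` J" "v = t + s"
      using fpair_obtain[OF pair', of v] vectors_mono[OF K_subset] by metis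
    then have "s \<in> vectors K" using v by auto
    moreover have "s i = 0" if "i \<in> K" for i using that ts stretch_J by auto
    ultimately have "s = 0" by (auto simp: vectors_def fun_eq_iff)
    then show "v \<in> extend L T" using ts by simp
  qed
  \<comment> \<open>Leaving out the block yields a set whose preimage \<open>S - K\<close> no longer
    cuts \<open>K\<close>.\<close>
  define R where "R = p ` (S - K)"
  have sub: "S - K \<subseteq> I'" "K \<subseteq> S - K \<or> K \<inter> (S - K) = {}" using S by auto
  note rs = stretch_restr_image[OF sub, folded R_def]
  have "j \<notin> R" using S K_def by (auto simp: R_def)
  have T1: "restr R t \<in> T" if "t \<in> T" for t
  proof -
    have "stretch t \<in> extend L T" using stretch_in_extend_iff zero_in_L that TV by blast
    then have "restr S (stretch t) \<in> extend L T" using sp by (auto simp: splits_def)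
    then obtain l u where lu: "l \<in> L" "u \<in> T" "restr S (stretch t) = l + stretch u"
      by (auto simp: extend_def)
    \<comment> \<open>The coordinate \<open>i2\<close> shows that \<open>u\<close> vanishes at
      \<open>j\<close>; so does the projection of \<open>t\<close> to \<open>R\<close>, since
      \<open>j\<close> is not in \<open>R\<close>.\<close>
    have "A i2 * u j = 0" using fun_cong[OF lu(3), of i2] i2 stretch_K by (simp add: restr_def)
    then have "u j = 0" using A_pos i2 K_subset by (metis DiffD1 mult_is_0 not_gr0 subsetD)
    have "stretch u i = stretch (restr R t) i" for i
    proof (cases "i \<in> K")
      case True
      then show ?thesis using stretch_K \<open>u j = 0\<close> \<open>j \<notin> R\<close> by (simp add: restr_def)
    next
      case False
      then have "l i = 0" using lu(1) by (auto simp: L_def vectors_def)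
      then show ?thesis using fun_cong[OF lu(3), of i] False unfolding rs by (simp add: restr_def)
    qed
    then have "u = restr R t"
      using stretch_inj restr_in_vectors lu(2) that TV(1) by (metis ext subsetD)
    then show ?thesis using lu by simp
  qed
  have T2: "restr (- R) t \<in> T" if "t \<in> T" for t
  proof -
    have st: "stretch t \<in> extend L T" using stretch_in_extend_iff zero_in_L that TV by blast
    then have 1: "restr (- S) (stretch t) \<in> extend L T" using sp by (auto simp: splits_def)
    \<comment> \<open>The projection off \<open>S\<close> lacks the entries of
      \<open>stretch t\<close> on the part of \<open>K\<close> inside \<open>S\<close>. These form a
      vector in the face of \<open>K\<close>, hence in \<open>extend L T\<close>, and are added back
      by recombination.\<close>
    have "restr (S \<inter> K) (stretch t) \<in> vectors K" by (auto simp: restr_def vectors_def)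
    then have 2: "restr (S \<inter> K) (stretch t) \<in> extend L T" using face by auto
    have "restr (S \<inter> K) (stretch t) \<in> vectors S" by (auto simp: restr_def vectors_def)
    then have "restr (S \<inter> K) (stretch t) + restr (- S) (stretch t) \<in> extend L T"
      using splits_recombine[OF pair' sp 2 _ 1] by simp
    moreover have "restr (S \<inter> K) (stretch t) + restr (- S) (stretch t) = stretch (restr (- R) t)"
      unfolding rs by (auto simp: restr_def)
    moreover have "restr (- R) t \<in> vectors I" using restr_in_vectors TV(1) that by blast
    ultimately show ?thesis
      using stretch_in_extend_iff[of L T] zero_in_L TV(1) by auto
  qed
  have J12: "restr R s \<in> J \<and> restr (- R) s \<in> J" if s: "s \<in> J" for s
  proof -
    have "stretch (restr R s) = restr S (stretch s)" "stretch (restr (- R) s) = restr (- S) (stretch s)"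
      unfolding rs using stretch_J[OF s] by (auto simp: restr_def fun_eq_iff)
    then have "stretch (restr R s) \<in> extend {0} J" "stretch (restr (- R) s) \<in> extend {0} J"
      using sp s by (auto simp: splits_def extend_zero)
    moreover have "restr R s \<in> vectors I" "restr (- R) s \<in> vectors I"
      using restr_in_vectors TV(2) s by blast+
    ultimately show ?thesis
      using stretch_in_extend_iff[of "{0}" J] zero_in_L TV(2) by auto
  qed
  show "splits (p ` (S - K)) T J" using T1 T2 J12 by (auto simp: splits_def R_def)
qed

text \<open>Both \<open>S\<close> and its complement cut \<open>K\<close>. If either had a
  coordinate outside \<open>K\<close>, the small pair would split along a nonempty set missing
  \<open>j\<close>. So \<open>I'\<close> is all block, \<open>I = {j}\<close>, and since
  \<open>J\<close> vanishes at \<open>j\<close> the pair is the excluded one.\<close>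

lemma fprim_extend_cut:
  assumes prim: "fprim I T J" and pair': "fpair I' (extend L T) (stretch ` J)"
    and S: "S \<subseteq> I'" "K \<inter> S \<noteq> {}" "K - S \<noteq> {}"
    and legal: "\<not> (I = {j} \<and> T = vectors I \<and> J = {0})"
  shows "\<not> splits S (extend L T) (stretch ` J)"
proof
  assume sp: "splits S (extend L T) (stretch ` J)"
  note pair = fprim_fpair[OF prim]
  have no: "S' \<subseteq> K"
    if S': "S' \<subseteq> I'" "K \<inter> S' \<noteq> {}" "K - S' \<noteq> {}" "splits S' (extend L T) (stretch ` J)" for S'
  proof (rule ccontr)
    assume "\<not> S' \<subseteq> K"
    then have "p ` (S' - K) \<noteq> {}" by auto
    moreover have "splits (p ` (S' - K)) T J"
      using splits_extend_cut(3)[OF pair pair' S'(1) _ _ S'(4)] S' by blast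
    moreover have "p ` (S' - K) \<subseteq> I" "j \<notin> p ` (S' - K)" using S' image_p K_def by auto
    ultimately show False using prim j_in by (auto simp: fprim_def)
  qed
  have "S \<subseteq> K" using no S sp by blast
  moreover have "I' - S \<subseteq> K"
    using no[of "I' - S"] S sp splits_diff[OF pair'] K_subset by blast
  ultimately have "I' = K" using K_subset by auto
  then have I: "I = {j}" using image_p K_def K_nonempty by auto
  have J0: "\<forall>s\<in>J. s j = 0" using splits_extend_cut(1)[OF pair pair' S(1) _ _ sp] S by blast
  have "s = 0" if "s \<in> J" for s
  proof
    fix i show "s i = 0 i"
      using J0 that fpair_subset[OF pair] vectorsD[of s I i] I by (cases "i = j") auto
  qed
  then have J: "J = {0}" using fpair_zero[OF pair] by auto
  have "T = vectors I"
    using fpair_subset[OF pair] fpair_obtain[OF pair] J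
        by (metis add_0_right singletonD subsetI subset_antisym)
  then show False using I J legal by simp
qed

lemma fprim_extend:
  assumes prim: "fprim I T J" and pair': "fpair I' (extend L T) (stretch ` J)"
    and legal: "\<not> (I = {j} \<and> T = vectors I \<and> J = {0})"
  shows "fprim I' (extend L T) (stretch ` J)"
  unfolding fprim_def
proof (intro conjI allI impI pair')
  fix S assume S: "S \<subseteq> I'" "S \<noteq> {}" "S \<noteq> I'"
  show "\<not> splits S (extend L T) (stretch ` J)"
  proof (cases "K \<subseteq> S \<or> K \<inter> S = {}")
    case True
    then show ?thesis
      using fprim_extend_uncut[of L "{0}" T J S] zero_in_L prim S by (auto simp: extend_zero)
  next
    case False
    then show ?thesis using fprim_extend_cut[OF prim pair' S(1) _ _ legal] by blast
  qed
qed

text \<open>A one-element block cannot be cut, so the uncut case covers every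
  \<open>S\<close>.\<close>

lemma fprim_extend_single:
  assumes "C \<subseteq> L" "0 \<in> C" "D \<subseteq> L" "0 \<in> D" and prim: "fprim I T J"
    and pair': "fpair I' (extend C T) (extend D J)" and K: "K = {k}"
  shows "fprim I' (extend C T) (extend D J)"
  unfolding fprim_def using fprim_extend_uncut[OF assms(1-5)] pair' K by blast

text \<open>A splitting set of the small pair is pulled back along \<open>p\<close>. Since
  \<open>L\<close> is closed downwards, it contains the projections of its elements, so the
  remainders do no harm.\<close>

lemma fprim_of_extend:
  assumes prim: "fprim I' (extend L T) (stretch ` J)" and pair: "fpair I T J"
  shows "fprim I T J"
  unfolding fprim_def
proof (intro conjI allI impI pair notI)
  fix S assume S: "S \<subseteq> I" "S \<noteq> {}" "S \<noteq> I" and sp: "splits S T J"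
  define R where "R = p -` S \<inter> I'"
  have restr_R: "restr R v = restr (p -` S) v" "restr (- R) v = restr (p -` (- S)) v"
    if "v \<in> vectors I'" for v
    using that by (auto simp: restr_def R_def vectors_def)
  have T: "restr (p -` U) (l + stretch t) \<in> extend L T" if "l \<in> L" "restr U t \<in> T" for U l t
  proof -
    have "restr (p -` U) l \<in> L"
      using L_le[OF that(1)] by (auto simp: le_fun_def restr_def)
    then show ?thesis using that by (auto simp: restr_add stretch_restr[symmetric] extend_def)
  qed
  have "splits R (extend L T) (stretch ` J)"
    unfolding splits_def
  proof (intro conjI ballI)
    fix t assume t: "t \<in> extend L T"
    then have v: "t \<in> vectors I'" using fpair_subset[OF fprim_fpair[OF prim]] by auto
    obtain l u where lu: "l \<in> L" "u \<in> T" "t = l + stretch u" using t by (auto simp: extend_def)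
    have "restr S u \<in> T" "restr (- S) u \<in> T" using lu sp by (auto simp: splits_def)
    then show "restr R t \<in> extend L T" "restr (- R) t \<in> extend L T"
      using T[OF lu(1)] restr_R[OF v] lu(3) by metis+
  next
    fix t assume "t \<in> stretch ` J"
    then show "restr R t \<in> stretch ` J" "restr (- R) t \<in> stretch ` J"
      using sp by (auto simp: splits_def restr_R stretch_restr[symmetric])
  qed
  moreover have "R \<subseteq> I'" "R \<noteq> {}" "R \<noteq> I'" using S image_p by (auto simp: R_def)
  ultimately show False using prim by (auto simp: fprim_def)
qed

end

section \<open>Reduction along a minimal element\<close>

definition unit_vec :: "'a \<Rightarrow> 'a \<Rightarrow> nat" where
  "unit_vec i = (\<lambda>k. if k = i then 1 else 0)"

definition minimal_in :: "('a \<Rightarrow> nat) set \<Rightarrow> ('a \<Rightarrow> nat) \<Rightarrow> bool" where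
  "minimal_in J s \<longleftrightarrow> s \<in> J \<and> s \<noteq> 0 \<and> (\<forall>s'\<in>J. s' \<le> s \<longrightarrow> s' = 0 \<or> s' = s)"

definition size_on :: "'a set \<Rightarrow> ('a \<Rightarrow> nat) \<Rightarrow> nat" where
  "size_on I v = (\<Sum>i\<in>I. v i)"

lemma size_on_add: "size_on I (u + v) = size_on I u + size_on I v"
  by (simp add: size_on_def sum.distrib)

lemma size_on_pos:
  assumes "finite I" "v \<in> vectors I" "v \<noteq> 0"
  shows "size_on I v > 0"
  using vectors_nonzero_obtain[OF assms(2,3)] assms(1)
  by (metis size_on_def bot_nat_0.not_eq_extremum sum_eq_0_iff)

lemma size_on_less:
  assumes "finite I" "v \<in> vectors I" "u \<le> v" "u \<noteq> v"
  shows "size_on I u < size_on I v"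
proof -
  have "v - u \<noteq> 0" "v - u \<in> vectors I" "v = u + (v - u)"
    using assms fun_diff_add[OF assms(3)] by (auto simp: vectors_def)
  then show ?thesis
    using size_on_pos[OF assms(1)] size_on_add[of I u "v - u"] by simp
qed

lemma minimal_below:
  assumes "finite I" "v \<in> vectors I" "v \<in> J" "v \<noteq> 0"
  obtains s where "minimal_in J s" "s \<le> v"
proof -
  have "\<exists>s. minimal_in J s \<and> s \<le> v"
    using assms(2-4)
  proof (induction "size_on I v" arbitrary: v rule: less_induct)
    case less
    show ?case
    proof (cases "minimal_in J v")
      case False
      then obtain u where u: "u \<in> J" "u \<le> v" "u \<noteq> 0" "u \<noteq> v"
        using less.prems by (auto simp: minimal_in_def)
      then show ?thesis
        using less.hyps[of u] size_on_less[OF assms(1) less.prems(1)] vectors_le[OF less.prems(1)]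
        by (meson order_trans)
    qed auto
  qed
  then show ?thesis using that by blast
qed

text \<open>Both sides are the join of \<open>u\<close> and \<open>v\<close>.\<close>

lemma add_diff_commute: "(u - v) + v = (v - u) + u" for u v :: "'a \<Rightarrow> nat"
  by (auto simp: fun_eq_iff)

section \<open>Block structure forced by a minimal element\<close>

context stretching
begin

text \<open>If a nonzero minimal \<open>s2 \<in> J'\<close> on the face of \<open>K\<close> were not above \<open>s\<close>, the join of
  \<open>s\<close> and \<open>s2\<close> would have the two representations \<open>(s2 - s) + s\<close> and \<open>(s - s2) + s2\<close>.\<close>

lemma L_subset_of_minimal:
  assumes pair: "fpair I' T' J'" and min: "minimal_in J' s"
    and s: "s \<in> vectors K" "\<And>i. i \<in> K \<Longrightarrow> s i = A i"
  shows "L \<subseteq> T'"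
proof
  fix l assume l: "l \<in> L"
  have s_pos: "s i > 0" if "i \<in> K" for i using that s A_pos K_subset by auto
  obtain t u where tu: "t \<in> T'" "u \<in> J'" "l = t + u"
    using fpair_obtain[OF pair] L_in_vectors[OF l] by metis
  have "u = 0"
  proof (rule ccontr)
    assume "u \<noteq> 0"
    have "u \<in> L" using L_le[OF l] tu add_fun_le by metis
    obtain r where r: "minimal_in J' r" "r \<le> u"
      using minimal_below[of I' u J'] finite_big L_in_vectors \<open>u \<in> L\<close> \<open>u \<noteq> 0\<close> tu by metis
    have rL: "r \<in> L" using L_le \<open>u \<in> L\<close> r by blast
    have "r \<noteq> 0" using r by (simp add: minimal_in_def)
    then obtain i where i: "r i > 0" "i \<in> K"
      using vectors_nonzero_obtain[of r K] rL by (auto simp: L_def)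
    \<comment> \<open>The \<open>J'\<close>-part of \<open>x - y\<close> lies below the minimal
      \<open>x\<close> and is smaller than it at \<open>i\<close>, where both \<open>x\<close> and
      \<open>y\<close> are positive; so it is 0.\<close>
    have diff_in: "x - y \<in> T'" if "minimal_in J' x" "x i > 0" "y i > 0" "x \<in> vectors I'" for x y
    proof -
      have "x - y \<in> vectors I'" using that by (auto simp: vectors_def)
      then obtain t' u' where tu': "t' \<in> T'" "u' \<in> J'" "x - y = t' + u'"
        using fpair_obtain[OF pair] by metis
      then have "u' \<le> x - y" using add_fun_le by metis
      moreover have "x - y \<le> x" by (simp add: le_fun_def)
      ultimately have "u' = 0 \<or> u' = x" using that(1) tu' unfolding minimal_in_def
          by (meson order_trans)
      moreover have "u' i < x i" using le_funD[OF \<open>u' \<le> x - y\<close>, of i] that by simp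
      ultimately have "u' = 0" by auto
      then show ?thesis using tu' by simp
    qed
    have "r - s \<in> T'" using diff_in r(1) i s_pos L_in_vectors[OF rL] by blast
    moreover have "s - r \<in> T'" using diff_in min i s_pos vectors_mono[OF K_subset s(1)] by blast
    ultimately have "s = r"
      using fpair_unique(2)[OF pair _ _ _ _ add_diff_commute[of r s]] r(1) min
      by (auto simp: minimal_in_def)
    then show False using rL s(2) by (auto simp: L_def)
  qed
  then show "l \<in> T'" using tu by simp
qed

text \<open>Two claims are proved together: \<open>J'\<close> contains only vectors with remainder
  0, and \<open>T'\<close> contains a whole translate of \<open>L\<close> or none of it. Induction
  on the total size works because, in a decomposition into nonzero parts from \<open>T'\<close> and
  \<open>J'\<close>, both parts are smaller, so their remainders are already under control.\<close>

lemma blocks_of_minimal: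
  assumes pair: "fpair I' T' J'" and min: "minimal_in J' s"
    and s: "s \<in> vectors K" "\<And>i. i \<in> K \<Longrightarrow> s i = A i"
    and "l \<in> L" "b \<in> vectors I"
  shows "(l + stretch b \<in> J' \<longrightarrow> l = 0) \<and> (l + stretch b \<in> T' \<longleftrightarrow> stretch b \<in> T')"
  using assms(5,6)
proof (induction "size_on I' (l + stretch b)" arbitrary: l b rule: less_induct)
  case less
  note l = less.prems(1) and b = less.prems(2)
  note LT = L_subset_of_minimal[OF pair min s]
  note zero = fpair_zero[OF pair] and lsum = fpair_left_of_sum[OF pair]
  have lT: "l \<in> T'" using LT l by auto
  have pos: "size_on I' v > 0" if "v \<in> T' \<union> J'" "v \<noteq> 0" for v
    using size_on_pos[OF finite_big] that fpair_subset[OF pair] by blast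
  \<comment> \<open>The slack \<open>w\<close> lets the induction hypothesis be used for parts of
    \<open>l + stretch b\<close> as well as for parts of \<open>stretch b\<close>.\<close>
  have IH_T: "stretch b1 \<in> T'"
    if "l1 \<in> L" "b1 \<in> vectors I" "l1 + stretch b1 \<in> T'" "u \<in> J'" "u \<noteq> 0"
      "l + stretch b = l1 + stretch b1 + u + w" for l1 b1 u w
    using less.hyps[of l1 b1] that pos[of u] by (simp add: size_on_add)
  have IH_J: "l2 = 0"
    if "l2 \<in> L" "b2 \<in> vectors I" "l2 + stretch b2 \<in> J'" "t \<in> T'" "t \<noteq> 0"
      "l + stretch b = t + (l2 + stretch b2) + w" for l2 b2 t w
    using less.hyps[of l2 b2] that pos[of t] by (simp add: size_on_add)
  show ?case
  proof (cases "stretch b = 0")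
    case True
    then show ?thesis using lT zero fpair_inter[OF pair lT] by auto
  next
    case b0: False
    obtain t u where tu: "t \<in> T'" "u \<in> J'" "stretch b = t + u"
      using fpair_obtain[OF pair, of "stretch b"] by auto
    obtain l1 b1 where t: "l1 \<in> L" "b1 \<in> vectors I" "t = l1 + stretch b1"
      using L_stretch_obtain[of t] fpair_subset[OF pair] tu by blast
    obtain l2 b2 where u: "l2 \<in> L" "b2 \<in> vectors I" "u = l2 + stretch b2"
      using L_stretch_obtain[of u] fpair_subset[OF pair] tu by blast
    consider "t \<noteq> 0" "u \<noteq> 0" | "t = 0" | "u = 0" by auto
    then show ?thesis
    proof cases
      \<comment> \<open>Here \<open>l + t\<close> is in \<open>T'\<close> by induction, so
        \<open>(l + t, u)\<close> represents \<open>l + stretch b\<close> with both parts nonzero.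
        That vector lies in neither set, and \<open>(t, u)\<close> keeps \<open>stretch b\<close>
        out of \<open>T'\<close>.\<close>
      case 1
      have sum: "l + stretch b = l1 + stretch b1 + u + l" "l + stretch b = t + (l2 + stretch b2) + l"
        using tu t u by (simp_all add: ac_simps)
      have b1T: "stretch b1 \<in> T'" using IH_T[OF t(1,2) _ tu(2) 1(2) sum(1)] tu t by simp
      have "l2 = 0" using IH_J[OF u(1,2) _ tu(1) 1(1) sum(2)] tu u by simp
      then have u': "u = stretch b2" using u by simp
      then have "stretch b = l1 + stretch (b1 + b2)"
        using tu t by (simp add: stretch_add ac_simps)
      then have "l1 = 0"
        using stretch_unique[of l1 "b1 + b2" b] t u b by simp
      then have t': "t = stretch b1" using t by simp
      have eq: "l + stretch b = l + t + u" using tu by (simp add: ac_simps)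
      then have "l + stretch b1 \<in> T'"
        using less.hyps[of l b1] t b1T l pos[of u] 1(2) tu by (simp add: size_on_add t')
      then have lt: "l + t \<in> T'" using t' by simp
      have "l + stretch b \<notin> T'" using lsum[OF _ lt tu(2)] 1(2) eq by metis
      moreover have "stretch b \<notin> T'" using lsum[OF _ tu(1,2)] 1(2) tu(3) by metis
      moreover have "l + stretch b \<notin> J'"
        using fpair_left_of_sum[OF fpair_swap[OF pair], of u "l + t"] lt tu(2) 1(1) eq
        by (auto simp: add.commute)
      ultimately show ?thesis by simp
    next
      \<comment> \<open>\<open>l\<close> is in \<open>T'\<close> and \<open>stretch b\<close> in
        \<open>J'\<close>, so \<open>(l, stretch b)\<close> is the representation of the
        sum.\<close>
      case 2
      then have bJ: "stretch b \<in> J'" using tu by simp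
      have "l + stretch b \<notin> T'" using lsum[OF _ lT bJ] b0 by auto
      moreover have "stretch b \<notin> T'" using lsum[of 0 "stretch b"] zero bJ b0 by auto
      moreover have "l = 0" if "l + stretch b \<in> J'"
        using fpair_left_of_sum[OF fpair_swap[OF pair], of "stretch b" l] that lT bJ
        by (simp add: add.commute)
      ultimately show ?thesis by simp
    next
      \<comment> \<open>Now \<open>stretch b\<close> is in \<open>T'\<close>, and
        \<open>l + stretch b\<close> has to be placed there too: first it is kept out of
        \<open>J'\<close>, then its \<open>J'\<close>-part is shown to vanish.\<close>
      case 3
      then have bT: "stretch b \<in> T'" using tu by simp
      have notJ: "l + stretch b \<notin> J'"
      proof
        assume lbJ: "l + stretch b \<in> J'"
        have l0: "l \<noteq> 0"
        proof
          assume "l = 0"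
          then show False using fpair_inter[OF pair bT] lbJ b0 by simp
        qed
        \<comment> \<open>The vector \<open>stretch b + (l \<squnion> s)\<close> equals both \<open>y + (l + stretch b)\<close> and
          \<open>(x + stretch b) + s\<close>.\<close>
        define x y where "x = l - s" and "y = s - l"
        have xL: "x \<in> L" using L_le[OF l] by (simp add: x_def le_fun_def)
        obtain i where i: "i \<in> K" "l i > 0"
          using vectors_nonzero_obtain[of l K] l l0 by (auto simp: L_def)
        have si: "s i > 0" using i s(2) A_pos K_subset by auto
        have "y \<in> vectors K" using s(1) by (auto simp: y_def vectors_def)
        moreover have "y i < A i" using i si s(2) by (simp add: y_def)
        ultimately have "y \<in> L" using i(1) by (auto simp: L_def)
        then have yT: "y \<in> T'" using LT by auto
        have "x i \<noteq> l i" using i si by (simp add: x_def)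
        then have "x \<noteq> l" by auto
        moreover have "x \<le> l" by (simp add: x_def le_fun_def)
        ultimately have "size_on I' x < size_on I' l"
          using size_on_less finite_big L_in_vectors[OF l] by blast
        then have xT: "x + stretch b \<in> T'"
          using less.hyps[of x b] xL b bT by (simp add: size_on_add)
        have "y + l = x + s" by (auto simp: x_def y_def)
        then have "y + (l + stretch b) = (x + stretch b) + s"
          by (metis add.assoc add.commute)
        then have "l + stretch b = s"
          using fpair_unique(2)[OF pair yT lbJ xT] min by (auto simp: minimal_in_def)
        \<comment> \<open>\<open>s\<close> itself has remainder 0, so its equality with
          \<open>l + stretch b\<close> contradicts \<open>l \<noteq> 0\<close>.\<close>
        moreover have "s = 0 + stretch (unit_vec j)"
        proof
          fix i
          show "s i = (0 + stretch (unit_vec j)) i"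
            using s K_subset K_def by (auto simp: stretch_def vectors_def unit_vec_def)
        qed
        moreover have "unit_vec j \<in> vectors I"
          using j_in by (auto simp: vectors_def unit_vec_def)
        ultimately show False using stretch_unique(1)[OF l b, of "unit_vec j"] l0 by simp
      qed
      have "l + stretch b \<in> T'"
      proof -
        obtain t u where tu: "t \<in> T'" "u \<in> J'" "l + stretch b = t + u"
          using fpair_obtain[OF pair, of "l + stretch b"] L_in_vectors[OF l] by auto
        obtain l1 b1 where t: "l1 \<in> L" "b1 \<in> vectors I" "t = l1 + stretch b1"
          using L_stretch_obtain[of t] fpair_subset[OF pair] tu by blast
        obtain l2 b2 where u: "l2 \<in> L" "b2 \<in> vectors I" "u = l2 + stretch b2"
          using L_stretch_obtain[of u] fpair_subset[OF pair] tu by blast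
        have t0: "t \<noteq> 0" using notJ tu by auto
        have "u = 0"
        proof (rule ccontr)
          assume u0: "u \<noteq> 0"
          have b1T: "stretch b1 \<in> T'" using IH_T[OF t(1,2) _ tu(2) u0, of 0] tu t by simp
          have "l2 = 0" using IH_J[OF u(1,2) _ tu(1) t0, of 0] tu u by simp
          then have u': "u = stretch b2" using u by simp
          have "l + stretch b = l1 + stretch (b1 + b2)"
            using tu t u' by (simp add: stretch_add ac_simps)
          then have "b = b1 + b2"
            using L_stretch_unique(2)[OF l t(1) b, of "b1 + b2"] t u by simp
          \<comment> \<open>Both \<open>stretch b\<close> and its part \<open>stretch b1\<close> are
            in \<open>T'\<close>, so the remaining part \<open>u\<close> from \<open>J'\<close>
            would have to be 0.\<close>
          then show False using lsum[of "stretch b1" u] b1T bT tu(2) u' u0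
              by (simp add: stretch_add)
        qed
        then show ?thesis using tu by simp
      qed
      then show ?thesis using bT notJ by simp
    qed
  qed
qed

text \<open>The small pair is read off from the vectors with remainder 0. It is a pair because the
  parts of \<open>stretch v\<close> leave no remainder: the \<open>J'\<close>-part has none, so by
  unique division the \<open>T'\<close>-part has none either.\<close>

lemma extend_of_minimal:
  assumes pair: "fpair I' T' J'" and min: "minimal_in J' s"
    and s: "s \<in> vectors K" "\<And>i. i \<in> K \<Longrightarrow> s i = A i"
  defines "T \<equiv> {b \<in> vectors I. stretch b \<in> T'}" and "J \<equiv> {b \<in> vectors I. stretch b \<in> J'}"
  shows "T' = extend L T" "J' = stretch ` J" "fpair I T J"
proof -
  note blocks = blocks_of_minimal[OF pair min s]
  show T': "T' = extend L T"
  proof (intro equalityI subsetI)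
    fix t assume "t \<in> T'"
    then obtain l b where lb: "l \<in> L" "b \<in> vectors I" "t = l + stretch b"
      using L_stretch_obtain[of t] fpair_subset[OF pair] by blast
    then show "t \<in> extend L T" using blocks[of l b] \<open>t \<in> T'\<close> by (auto simp: extend_def T_def)
  next
    fix t assume "t \<in> extend L T"
    then show "t \<in> T'" using blocks by (auto simp: extend_def T_def)
  qed
  show J': "J' = stretch ` J"
  proof (intro equalityI subsetI)
    fix t assume "t \<in> J'"
    then obtain l b where lb: "l \<in> L" "b \<in> vectors I" "t = l + stretch b"
      using L_stretch_obtain[of t] fpair_subset[OF pair] by blast
    then show "t \<in> stretch ` J" using blocks[of l b] \<open>t \<in> J'\<close> by (auto simp: J_def)
  qed (auto simp: J_def)
  show "fpair I T J"
  proof (rule fpairI)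
    fix v assume v: "v \<in> vectors I"
    obtain t u where tu: "t \<in> T'" "u \<in> J'" "stretch v = t + u"
      using fpair_obtain[OF pair, of "stretch v"] by auto
    obtain l b c where lbc: "l \<in> L" "b \<in> T" "c \<in> J" "t = l + stretch b" "u = stretch c"
      using tu T' J' by (auto simp: extend_def)
    have V: "b \<in> vectors I" "c \<in> vectors I" using lbc by (auto simp: T_def J_def)
    have "l + stretch (b + c) = stretch v" using tu lbc by (simp add: stretch_add ac_simps)
    then have "v = b + c" using stretch_unique(2)[OF lbc(1) _ v, of "b + c"] V by simp
    then show "\<exists>t\<in>T. \<exists>s\<in>J. v = t + s" using lbc by blast
  next
    fix t u t' u' assume h: "t \<in> T" "u \<in> J" "t' \<in> T" "u' \<in> J" "t + u = t' + u'"
    then have "stretch t + stretch u = stretch t' + stretch u'"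
        by (simp add: stretch_add[symmetric])
    then have "stretch t = stretch t'" "stretch u = stretch u'"
      using fpair_unique[OF pair] h by (auto simp: T_def J_def)
    then show "t = t' \<and> u = u'" using stretch_inj h by (auto simp: T_def J_def)
  qed (auto simp: T_def J_def)
qed

end

text \<open>If the \<open>J\<close>-part of such a vector were nonzero, a minimal element below it
  would be some \<open>unit_vec i\<close> in \<open>J\<close>. But \<open>i\<close> is in the
  support of the vector, so \<open>unit_vec i\<close> is in \<open>T\<close> too, which is
  impossible.\<close>

lemma vectors_unit_subset:
  assumes fin: "finite I" and pair: "fpair I T J"
    and units: "\<And>s. minimal_in J s \<Longrightarrow> \<exists>i. s = unit_vec i"
  shows "vectors {i \<in> I. unit_vec i \<in> T} \<subseteq> T"
proof
  fix v assume v: "v \<in> vectors {i \<in> I. unit_vec i \<in> T}"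
  then have "v \<in> vectors I" by (auto simp: vectors_def)
  then obtain t u where tu: "t \<in> T" "u \<in> J" "v = t + u" using fpair_obtain[OF pair] by metis
  have "u = 0"
  proof (rule ccontr)
    assume "u \<noteq> 0"
    then obtain s where s: "minimal_in J s" "s \<le> u"
      using minimal_below[OF fin _ tu(2)] fpair_subset[OF pair] tu(2) by blast
    obtain i where i: "s = unit_vec i" using units s by blast
    have "unit_vec i \<in> J" "unit_vec i \<noteq> 0" using s i by (auto simp: minimal_in_def)
    moreover have "v i > 0"
      using le_funD[OF s(2), of i] tu(3) by (simp add: i unit_vec_def)
    then have "unit_vec i \<in> T" using v by (auto simp: vectors_def)
    ultimately show False using fpair_inter[OF pair] by blast
  qed
  then show "v \<in> T" using tu by simp
qed

lemma nonunit_minimal: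
  assumes fin: "finite I" and prim: "fprim I T J" and I: "i0 \<in> I" "I \<noteq> {i0}"
  obtains s where "minimal_in J s \<or> minimal_in T s" "\<And>i. s \<noteq> unit_vec i"
proof -
  note pair = fprim_fpair[OF prim]
  have False if "\<And>s. minimal_in J s \<or> minimal_in T s \<Longrightarrow> \<exists>i. s = unit_vec i"
  proof -
    define X where "X = {i \<in> I. unit_vec i \<in> T}"
    define Y where "Y = {i \<in> I. unit_vec i \<in> J}"
    have sub: "vectors X \<subseteq> T" "vectors Y \<subseteq> J"
      using vectors_unit_subset[OF fin pair] vectors_unit_subset[OF fin fpair_swap[OF pair]] that
      by (auto simp: X_def Y_def)
    \<comment> \<open>A minimal element below a part of \<open>unit_vec i\<close> is a unit vector,
      hence \<open>unit_vec i\<close> itself.\<close>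
    have XY: "I \<subseteq> X \<union> Y"
    proof
      fix i assume i: "i \<in> I"
      then have "unit_vec i \<in> vectors I" by (auto simp: vectors_def unit_vec_def)
      then obtain t u where tu: "t \<in> T" "u \<in> J" "unit_vec i = t + u"
        using fpair_obtain[OF pair] by metis
      have "unit_vec i \<noteq> 0" by (auto simp: unit_vec_def fun_eq_iff)
      then have "t \<noteq> 0 \<or> u \<noteq> 0" using tu by auto
      then obtain s where s: "minimal_in J s \<or> minimal_in T s" "s \<le> unit_vec i"
      proof
        assume "t \<noteq> 0"
        then obtain s where "minimal_in T s" "s \<le> t"
          using minimal_below[OF fin _ tu(1)] fpair_subset[OF pair] tu by blast
        then show ?thesis using that tu(3) add_fun_le(1)[of t u] by (metis order_trans)
      next
        assume "u \<noteq> 0"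
        then obtain s where "minimal_in J s" "s \<le> u"
          using minimal_below[OF fin _ tu(2)] fpair_subset[OF pair] tu by blast
        then show ?thesis using that tu(3) add_fun_le(2)[of u t] by (metis order_trans)
      qed
      then obtain k where k: "s = unit_vec k"
        using \<open>\<And>s. minimal_in J s \<or> minimal_in T s \<Longrightarrow> \<exists>i. s = unit_vec i\<close> by blast
      have "k = i"
        using le_funD[OF s(2), of k] k by (auto simp: unit_vec_def split: if_splits)
      then show "i \<in> X \<union> Y" using s k i by (auto simp: minimal_in_def X_def Y_def)
    qed
    \<comment> \<open>The part of \<open>t\<close> off \<open>Z\<close> lies in the other face,
      hence in \<open>W\<close>, while the part on \<open>Z\<close> lies in \<open>U\<close>; since
      \<open>t\<close> is in \<open>U\<close>, the former is 0.\<close>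
    have eq: "U = vectors Z"
      if "fpair I U W" "vectors Z \<subseteq> U" "vectors Z' \<subseteq> W" "I \<subseteq> Z \<union> Z'" for U W Z Z'
    proof
      show "U \<subseteq> vectors Z"
      proof
        fix t assume t: "t \<in> U"
        then have "t \<in> vectors I" using fpair_subset that(1) by blast
        then have "restr (- Z) t \<in> vectors Z'"
          using that(4) by (fastforce simp: restr_def vectors_def)
        then have "restr (- Z) t \<in> W" "restr Z t \<in> U" using that(2,3) by auto
        then have "restr (- Z) t = 0"
          using fpair_left_of_sum[OF that(1)] t restr_compl_split[of Z t] by metis
        then have "t = restr Z t" using restr_compl_split[of Z t] by simp
        then show "t \<in> vectors Z" by (metis restr_in_vectors_self)
      qed
    qed (use that in auto)
    have "T = vectors X" "J = vectors Y"
      using eq[OF pair sub XY] eq[OF fpair_swap[OF pair] sub(2,1)] XY by auto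
    then have "splits {i0} T J"
      by (auto simp: splits_def intro: restr_in_vectors)
    then show False using prim I by (auto simp: fprim_def)
  qed
  then show ?thesis using that by blast
qed

text \<open>Witnesses against the splitting set \<open>{i}\<close>, sorted by their height on the
  axis of \<open>i\<close>.\<close>

definition fails_at :: "'a \<Rightarrow> ('a \<Rightarrow> nat) set \<Rightarrow> nat \<Rightarrow> bool" where
  "fails_at i U m \<longleftrightarrow>
     (\<exists>t\<in>U. t i = m \<and> \<not> (restr {i} t \<in> U \<and> restr (- {i}) t \<in> U))"

text \<open>This level drops when the axis of \<open>i\<close> is compressed by a first type reduction; its sum
  over all \<open>i\<close> is the termination measure.\<close>

definition split_level :: "('a \<Rightarrow> nat) set \<Rightarrow> ('a \<Rightarrow> nat) set \<Rightarrow> 'a \<Rightarrow> nat" where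
  "split_level T J i = (LEAST m. fails_at i T m \<or> fails_at i J m)"

lemma split_level_swap: "split_level T J = split_level J T"
  by (simp add: split_level_def disj_commute fun_eq_iff)

text \<open>Ensures that the \<open>LEAST\<close> in \<open>split_level\<close> is attained rather
  than unspecified: \<open>{i}\<close> is a proper subset of \<open>I\<close>, so it does not split
  the pair.\<close>

lemma fprim_fails:
  assumes "fprim I T J" "i \<in> I" "I \<noteq> {i}"
  shows "\<exists>m. fails_at i T m \<or> fails_at i J m"
proof -
  have "\<not> splits {i} T J" using assms by (auto simp: fprim_def)
  then show ?thesis by (auto simp: splits_def fails_at_def)
qed

context stretching
begin

text \<open>If \<open>c + stretch b\<close> is a witness, so is \<open>b\<close>, because
  \<open>C\<close> is closed under projections. The heights satisfy
  \<open>m = c i + A i * b (p i)\<close>. A vector of height 0 is no witness, so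
  \<open>b (p i)\<close> is nonzero, and on the compressed axis \<open>A k \<ge> 2\<close> makes the
  drop strict.\<close>

lemma fails_at_extend:
  assumes K: "K = {k}" "A k \<ge> 2" and C: "\<And>c S. c \<in> C \<Longrightarrow> restr S c \<in> C" and U: "0 \<in> U"
    and i: "i \<in> I'" and fail: "fails_at i (extend C U) m"
  obtains m' where "fails_at (p i) U m'" "m' \<le> m" "i = k \<Longrightarrow> m' < m"
proof -
  obtain c b where cb: "c \<in> C" "b \<in> U" "c i + stretch b i = m"
    and nsp: "\<not> (restr {i} (c + stretch b) \<in> extend C U \<and> restr (- {i}) (c + stretch b) \<in> extend C U)"
    using fail by (force simp: fails_at_def extend_def)
  have "restr {i} (stretch b) = stretch (restr {p i} b)" "restr (- {i}) (stretch b) = stretch (restr (- {p i}) b)"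
    using stretch_restr_image[of "{i}" b] i K(1) by (cases "i = k"; simp)+
  then have nb: "\<not> (restr {p i} b \<in> U \<and> restr (- {p i}) b \<in> U)"
    using nsp C[OF cb(1)] by (auto simp: restr_add extend_def)
  then have "fails_at (p i) U (b (p i))" using cb by (auto simp: fails_at_def)
  moreover have m: "m = c i + A i * b (p i)" using cb i by (simp add: stretch_def)
  then have "b (p i) \<le> m" using A_pos[OF i] by (simp add: trans_le_add2)
  moreover have "b (p i) < m" if "i = k"
  proof -
    have "b (p i) \<noteq> 0"
    proof
      assume "b (p i) = 0"
      then have "restr {p i} b = 0" "restr (- {p i}) b = b" by (auto simp: restr_def fun_eq_iff)
      then show False using nb U cb by simp
    qed
    moreover have "2 * b (p i) \<le> A i * b (p i)" using K that by simp
    ultimately show ?thesis using m by linarith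
  qed
  ultimately show ?thesis using that by blast
qed

lemma sum_split_level_less:
  assumes K: "K = {k}" "A k \<ge> 2" and prim: "fprim I' (extend L T) (stretch ` J)"
    and pair: "fpair I T J" and I': "I' \<noteq> {k}"
  shows "sum (split_level T J) I < sum (split_level (extend L T) (stretch ` J)) I'"
proof -
  have le: "split_level T J (p i) \<le> split_level (extend L T) (stretch ` J) i \<and>
    (i = k \<longrightarrow> split_level T J (p i) < split_level (extend L T) (stretch ` J) i)"
    if i: "i \<in> I'" for i
  proof -
    let ?m = "split_level (extend L T) (stretch ` J) i"
    have "I' \<noteq> {i}" using I' K K_subset by auto
    then have "fails_at i (extend L T) ?m \<or> fails_at i (extend {0} J) ?m"
      using LeastI_ex[OF fprim_fails[OF prim i]] by (auto simp: split_level_def extend_zero)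
    then obtain m' where m': "fails_at (p i) T m' \<or> fails_at (p i) J m'" "m' \<le> ?m" "i = k \<Longrightarrow> m' < ?m"
    proof
      assume *: "fails_at i (extend L T) ?m"
      have "restr S c \<in> L" if "c \<in> L" for c S
        using L_le[OF that] by (auto simp: le_fun_def restr_def)
      then show ?thesis using fails_at_extend[OF K _ _ i *] that fpair_zero[OF pair] by metis
    next
      assume *: "fails_at i (extend {0} J) ?m"
      show ?thesis using fails_at_extend[OF K _ _ i *] that fpair_zero[OF pair]
        by (metis restr_0 singleton_iff)
    qed
    have "split_level T J (p i) \<le> m'" using m'(1) by (auto simp: split_level_def intro: Least_le)
    then show ?thesis using m' by fastforce
  qed
  \<comment> \<open>With a one-element block \<open>p\<close> is a bijection, so the two sums can be
    compared term by term.\<close>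
  have inj: "inj_on p I'"
  proof (rule inj_onI)
    fix x y assume xy: "x \<in> I'" "y \<in> I'" "p x = p y"
    then have "x \<in> K \<longleftrightarrow> y \<in> K" by (simp add: K_def)
    then show "x = y" using inj_onD[OF inj_p, of x y] xy K(1) by (cases "x \<in> K") auto
  qed
  have "sum (split_level T J) I = (\<Sum>i\<in>I'. split_level T J (p i))"
    using sum.reindex[OF inj, of "split_level T J"] image_p by simp
  also have "\<dots> < sum (split_level (extend L T) (stretch ` J)) I'"
    using le K K_subset by (intro sum_strict_mono_ex1[OF finite_big]) auto
  finally show ?thesis .
qed

end

section \<open>Lists as functions\<close>

text \<open>Padding by zeros forgets the length, so \<open>enc\<close> is injective only on each
  \<open>vecs n\<close> separately.\<close>

definition enc :: "nat list \<Rightarrow> nat \<Rightarrow> nat" where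
  "enc v = (\<lambda>i. if i < length v then v ! i else 0)"

definition dec :: "nat \<Rightarrow> (nat \<Rightarrow> nat) \<Rightarrow> nat list" where
  "dec n f = map f [0..<n]"

lemma enc_in_vectors: "v \<in> vecs n \<Longrightarrow> enc v \<in> vectors {..<n}"
  by (auto simp: enc_def vectors_def vecs_def)

lemma dec_in_vecs [simp]: "dec n f \<in> vecs n"
  by (simp add: dec_def vecs_def)

lemma enc_dec: "f \<in> vectors {..<n} \<Longrightarrow> enc (dec n f) = f"
  by (auto simp: enc_def dec_def vectors_def fun_eq_iff)

lemma enc_inj: "u \<in> vecs n \<Longrightarrow> v \<in> vecs n \<Longrightarrow> enc u = enc v \<Longrightarrow> u = v"
  by (rule nth_equalityI) (auto simp: vecs_def enc_def fun_eq_iff split: if_splits)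

lemma enc_image_iff:
  assumes "T \<subseteq> vecs n" "v \<in> vecs n"
  shows "enc v \<in> enc ` T \<longleftrightarrow> v \<in> T"
  using assms enc_inj by blast

lemma enc_image_dec: "F \<subseteq> vectors {..<n} \<Longrightarrow> enc ` dec n ` F = F"
  using enc_dec by (auto simp: image_image image_def) (metis subsetD)+

lemma length_vadd [simp]: "length (vadd u v) = min (length u) (length v)"
  by (simp add: vadd_def)

lemma vadd_in_vecs [simp]: "u \<in> vecs n \<Longrightarrow> v \<in> vecs n \<Longrightarrow> vadd u v \<in> vecs n"
  by (simp add: vecs_def)

lemma vadd_append:
  "length u = length u' \<Longrightarrow> vadd (u @ v) (u' @ v') = vadd u u' @ vadd v v'"
  by (simp add: vadd_def)

lemma vadd_commute: "vadd u v = vadd v u"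
  by (auto simp: vadd_def list_eq_iff_nth_eq)

lemma vadd_0: "u \<in> vecs n \<Longrightarrow> vadd u (replicate n 0) = u"
  by (auto simp: vadd_def vecs_def list_eq_iff_nth_eq)

lemma enc_vadd: "u \<in> vecs n \<Longrightarrow> v \<in> vecs n \<Longrightarrow> enc (vadd u v) = enc u + enc v"
  by (auto simp: enc_def vadd_def vecs_def fun_eq_iff)

lemma enc_replicate_0 [simp]: "enc (replicate n 0) = 0"
  by (auto simp: enc_def fun_eq_iff)

lemma zero_in_vecs [simp]: "replicate n 0 \<in> vecs n"
  by (simp add: vecs_def)

lemma ex1_pair:
  "(\<exists>!p. p \<in> A \<times> B \<and> P (fst p) (snd p)) \<longleftrightarrow>
    (\<exists>t\<in>A. \<exists>s\<in>B. P t s \<and> (\<forall>t'\<in>A. \<forall>s'\<in>B. P t' s' \<longrightarrow> t' = t \<and> s' = s))"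
  by (simp add: Ex1_def split_paired_Ex split_paired_All) blast

lemma is_pair_iff_fpair:
  "is_pair n T J \<longleftrightarrow> n \<ge> 1 \<and> T \<subseteq> vecs n \<and> J \<subseteq> vecs n \<and> fpair {..<n} (enc ` T) (enc ` J)"
proof (cases "n \<ge> 1 \<and> T \<subseteq> vecs n \<and> J \<subseteq> vecs n")
  case True
  then have T: "T \<subseteq> vecs n" and J: "J \<subseteq> vecs n" by auto
  have bij: "(\<exists>!p. p \<in> T \<times> J \<and> vadd (fst p) (snd p) = v) \<longleftrightarrow>
    (\<exists>!p. p \<in> enc ` T \<times> enc ` J \<and> fst p + snd p = enc v)" (is "?A \<longleftrightarrow> ?B")
    if v: "v \<in> vecs n" for v
  proof -
    have eq: "enc t + enc s = enc v \<longleftrightarrow> vadd t s = v" if "t \<in> T" "s \<in> J" for t s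
    proof -
      have "t \<in> vecs n" "s \<in> vecs n" using that T J by auto
      then show ?thesis using enc_vadd[of t n s] enc_inj[of "vadd t s" n v] v by auto
    qed
    have "enc t' = enc t \<longleftrightarrow> t' = t" if "t \<in> T \<union> J" "t' \<in> T \<union> J" for t t'
      using enc_inj[of t' n t] that T J by auto
    then show ?thesis
      unfolding ex1_pair[where P = "\<lambda>t s. vadd t s = v"] ex1_pair[where P = "\<lambda>t s. t + s = enc v"]
      by (simp add: eq cong: ball_cong bex_cong)
  qed
  have "vectors {..<n} = enc ` vecs n"
    using enc_dec enc_in_vectors
        by (metis (no_types, lifting) dec_in_vecs image_eqI image_subsetI subsetI subset_antisym)
  then have "fpair {..<n} (enc ` T) (enc ` J) \<longleftrightarrow>
      (\<forall>v\<in>vecs n. \<exists>!p. p \<in> enc ` T \<times> enc ` J \<and> fst p + snd p = enc v)"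
    using T J by (simp add: fpair_def image_mono)
  then show ?thesis
    using True bij by (simp add: is_pair_def)
qed (auto simp: is_pair_def)

lemma is_pair_swap: "is_pair n T J \<Longrightarrow> is_pair n J T"
  using is_pair_iff_fpair fpair_swap by metis

lemma is_pair_zero:
  assumes "is_pair n T J"
  shows "replicate n 0 \<in> T" "replicate n 0 \<in> J"
  using fpair_zero[of "{..<n}" "enc ` T" "enc ` J"] assms enc_inj
  by (metis enc_image_iff enc_replicate_0 is_pair_iff_fpair zero_in_vecs)+

lemma is_pair_obtain:
  assumes "is_pair n T J" "v \<in> vecs n"
  obtains t s where "t \<in> T" "s \<in> J" "v = vadd t s"
proof -
  have "\<exists>!p. p \<in> T \<times> J \<and> vadd (fst p) (snd p) = v" using assms by (simp add: is_pair_def)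
  then show ?thesis using that by (metis mem_Times_iff)
qed

lemma is_pairI:
  assumes "n \<ge> 1" "T \<subseteq> vecs n" "J \<subseteq> vecs n"
    and "\<And>v. v \<in> vecs n \<Longrightarrow> \<exists>t\<in>T. \<exists>s\<in>J. v = vadd t s"
    and "\<And>t s t' s'. \<lbrakk>t \<in> T; s \<in> J; t' \<in> T; s' \<in> J; vadd t s = vadd t' s'\<rbrakk> \<Longrightarrow> t = t' \<and> s = s'"
  shows "is_pair n T J"
  unfolding is_pair_def
proof (intro conjI ballI)
  fix v assume "v \<in> vecs n"
  then obtain t s where "t \<in> T" "s \<in> J" "v = vadd t s" using assms(4) by blast
  then show "\<exists>!p. p \<in> T \<times> J \<and> vadd (fst p) (snd p) = v"
    using assms(5)[of _ _ t s] by (intro ex1I[of _ "(t, s)"]) auto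
qed (use assms in auto)

lemma is_pair_unique:
  assumes "is_pair n T J" "t \<in> T" "s \<in> J" "t' \<in> T" "s' \<in> J" "vadd t s = vadd t' s'"
  shows "t = t'" "s = s'"
proof -
  have pr: "fpair {..<n} (enc ` T) (enc ` J)"
      and V: "t \<in> vecs n" "s \<in> vecs n" "t' \<in> vecs n" "s' \<in> vecs n"
    using assms is_pair_iff_fpair by auto
  have "enc t + enc s = enc t' + enc s'" using assms(6) V enc_vadd by metis
  then show "t = t'" "s = s'"
    using fpair_unique[OF pr, of "enc t" "enc s" "enc t'" "enc s'"] assms(2-5) V enc_inj by auto
qed

section \<open>Permutations of coordinates and Cartesian products\<close>

lemma enc_permute_list:
  assumes "\<pi> permutes {..<n}" "v \<in> vecs n"
  shows "enc (permute_list \<pi> v) = enc v \<circ> \<pi>"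
proof
  fix i
  show "enc (permute_list \<pi> v) i = (enc v \<circ> \<pi>) i"
    using assms permute_list_nth[of \<pi> v i] permutes_in_image[OF assms(1), of i]
    by (auto simp: enc_def vecs_def)
qed

lemma permute_list_in_vecs [simp]: "permute_list \<pi> v \<in> vecs n \<longleftrightarrow> v \<in> vecs n"
  by (simp add: vecs_def)

lemma permute_list_inj:
  assumes "\<pi> permutes {..<n}" "u \<in> vecs n" "v \<in> vecs n" "permute_list \<pi> u = permute_list \<pi> v"
  shows "u = v"
proof -
  have "enc u \<circ> \<pi> = enc v \<circ> \<pi>" using assms enc_permute_list by metis
  then have "enc u = enc v" using permutes_surj[OF assms(1)] by (metis fun.map_cong0 surj_fun_eq)
  then show ?thesis using enc_inj assms by blast
qed

lemma permute_list_surj: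
  assumes "\<pi> permutes {..<n}" "v \<in> vecs n"
  obtains u where "u \<in> vecs n" "v = permute_list \<pi> u"
proof
  have *: "inv \<pi> permutes {..<n}" using assms(1) by (rule permutes_inv)
  show "permute_list (inv \<pi>) v \<in> vecs n" using assms by simp
  have "enc (permute_list \<pi> (permute_list (inv \<pi>) v)) = enc v"
    using enc_permute_list[OF assms(1)] enc_permute_list[OF * assms(2)] assms
    by (simp add: comp_assoc permutes_inv_o(2)[OF assms(1)])
  then show "v = permute_list \<pi> (permute_list (inv \<pi>) v)"
    using enc_inj[of v n] assms by simp
qed

lemma permute_list_vadd:
  assumes "\<pi> permutes {..<n}" "u \<in> vecs n" "v \<in> vecs n"
  shows "permute_list \<pi> (vadd u v) = vadd (permute_list \<pi> u) (permute_list \<pi> v)"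
  using assms
      by (intro enc_inj[of _ n]) (simp_all add: enc_permute_list enc_vadd plus_fun_def comp_def)

text \<open>Position \<open>i\<close> of a list permuted by \<open>\<pi>\<close> holds the old entry
  \<open>\<pi> i\<close>, so \<open>S\<close> collects the positions filled from the first
  factor.\<close>

lemma restr_enc_permute_append:
  assumes \<pi>: "\<pi> permutes {..<p + q}" and u: "u \<in> vecs p" and v: "v \<in> vecs q"
  defines "S \<equiv> {i. \<pi> i < p}"
  shows "restr S (enc (permute_list \<pi> (u @ v))) = enc (permute_list \<pi> (u @ replicate q 0))"
    and "restr (- S) (enc (permute_list \<pi> (u @ v))) = enc (permute_list \<pi> (replicate p 0 @ v))"
proof -
  have "u @ v \<in> vecs (p + q)" "u @ replicate q 0 \<in> vecs (p + q)" "replicate p 0 @ v \<in> vecs (p + q)"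
    using u v by (auto simp: vecs_def)
  note e = this[THEN enc_permute_list[OF \<pi>]]
  show "restr S (enc (permute_list \<pi> (u @ v))) = enc (permute_list \<pi> (u @ replicate q 0))"
    "restr (- S) (enc (permute_list \<pi> (u @ v))) = enc (permute_list \<pi> (replicate p 0 @ v))"
    using u v unfolding e by (auto simp: restr_def S_def enc_def vecs_def nth_append fun_eq_iff)
qed

text \<open>Sorts \<open>S\<close> to the front by gluing bijections on \<open>S\<close> and on its
  complement. It serves both to exhibit a product and to turn the support of a minimal element into
  an initial block.\<close>

lemma permutes_subset_to_initial:
  assumes "S \<subseteq> {..<n}"
  obtains \<sigma> where "\<sigma> permutes {..<n}" "\<And>i. i < n \<Longrightarrow> \<sigma> i < card S \<longleftrightarrow> i \<in> S"
proof -
  have fin: "finite S" using assms finite_subset by blast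
  have le: "card S \<le> n" using card_mono[OF _ assms] by simp
  obtain f where f: "bij_betw f S {..<card S}"
    using finite_same_card_bij[of S "{..<card S}"] fin by auto
  obtain g where g: "bij_betw g ({..<n} - S) {card S..<n}"
    using finite_same_card_bij[of "{..<n} - S" "{card S..<n}"] card_Diff_subset[OF fin assms]
        by auto
  define \<sigma> where "\<sigma> i = (if i \<in> S then f i else if i < n then g i else i)" for i
  have f': "bij_betw \<sigma> S {..<card S}"
    using f by (rule bij_betw_cong[THEN iffD1, rotated]) (simp add: \<sigma>_def)
  have g': "bij_betw \<sigma> ({..<n} - S) {card S..<n}"
    using g by (rule bij_betw_cong[THEN iffD1, rotated]) (auto simp: \<sigma>_def)
  have "bij_betw \<sigma> (S \<union> ({..<n} - S)) ({..<card S} \<union> {card S..<n})"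
    using f' g' by (rule bij_betw_combine) auto
  moreover have "S \<union> ({..<n} - S) = {..<n}" "{..<card S} \<union> {card S..<n} = {..<n}"
    using assms le by auto
  ultimately have "bij_betw \<sigma> {..<n} {..<n}" by simp
  then have "\<sigma> permutes {..<n}"
    using assms by (intro bij_imp_permutes) (auto simp: \<sigma>_def)
  moreover have "\<sigma> i < card S \<longleftrightarrow> i \<in> S" if "i < n" for i
    using bij_betwE[OF f'] bij_betwE[OF g'] that by (cases "i \<in> S") force+
  ultimately show ?thesis using that by blast
qed

lemma cart_is_not_fprim:
  assumes 1: "is_pair p I1 J1" and 2: "is_pair q I2 J2"
      and perm: "permuted (p + q) T J (cart I1 I2) (cart J1 J2)"
  shows "\<not> fprim {..<p + q} (enc ` T) (enc ` J)"
proof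
  assume prim: "fprim {..<p + q} (enc ` T) (enc ` J)"
  obtain \<pi>
      where \<pi>: "\<pi> permutes {..<p + q}" "T = permute_list \<pi> ` cart I1 I2" "J = permute_list \<pi> ` cart J1 J2"
    using perm by (auto simp: permuted_def)
  define S where "S = {i. \<pi> i < p}"
  have pq: "p \<ge> 1" "q \<ge> 1" using 1 2 by (auto simp: is_pair_def)
  have V: "I1 \<subseteq> vecs p" "J1 \<subseteq> vecs p" "I2 \<subseteq> vecs q" "J2 \<subseteq> vecs q"
    using 1 2 by (auto simp: is_pair_def)
  have "restr S t \<in> enc ` permute_list \<pi> ` cart A B \<and> restr (- S) t \<in> enc ` permute_list \<pi> ` cart A B"
    if t: "t \<in> enc ` permute_list \<pi> ` cart A B" and A: "A \<subseteq> vecs p" "replicate p 0 \<in> A"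
      and B: "B \<subseteq> vecs q" "replicate q 0 \<in> B" for t A B
  proof -
    obtain u v where uv: "u \<in> A" "v \<in> B" "t = enc (permute_list \<pi> (u @ v))"
      using t by (auto simp: cart_def)
    then have "u @ replicate q 0 \<in> cart A B" "replicate p 0 @ v \<in> cart A B"
      using A B by (auto simp: cart_def)
    moreover have "u \<in> vecs p" "v \<in> vecs q" using uv A B by auto
    ultimately show ?thesis
      using restr_enc_permute_append[OF \<pi>(1), of u v] unfolding uv(3) S_def by simp
  qed
  then have "splits S (enc ` T) (enc ` J)"
    using V is_pair_zero[OF 1] is_pair_zero[OF 2] unfolding splits_def \<pi>(2,3) by blast
  \<comment> \<open>The complement within the index set is taken because it is contained in that set
    by construction.\<close>
  then have split: "splits ({..<p + q} - S) (enc ` T) (enc ` J)"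
    using splits_diff[OF fprim_fpair[OF prim]] by blast
  \<comment> \<open>\<open>a\<close> is a position filled from the first factor and \<open>b\<close>
    one filled from the second; they make the splitting set proper and nonempty.\<close>
  obtain a b where "\<pi> a = 0" "\<pi> b = p"
    using permutes_surj[OF \<pi>(1)] by (metis surjD)
  moreover from this have "a < p + q" "b < p + q"
    using permutes_in_image[OF \<pi>(1), of a] permutes_in_image[OF \<pi>(1), of b] pq by auto
  ultimately have "a \<notin> {..<p + q} - S" "b \<in> {..<p + q} - S" "a \<in> {..<p + q}"
    using pq by (auto simp: S_def)
  then have "{..<p + q} - S \<subseteq> {..<p + q}" "{..<p + q} - S \<noteq> {}" "{..<p + q} - S \<noteq> {..<p + q}"
    by blast+
  then show False
    using prim split unfolding fprim_def by blast
qed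

text \<open>A pair induces a pair on a coordinate face embedded by \<open>P\<close>: by
  \<open>face\<close>, both parts of a vector in the face stay in the face.\<close>

lemma is_pair_factor:
  assumes pair: "is_pair n T J" and P: "inj_on P (vecs p)" "\<And>u. u \<in> vecs p \<Longrightarrow> P u \<in> vecs n" "p \<ge> 1"
    and add: "\<And>u v. u \<in> vecs p \<Longrightarrow> v \<in> vecs p \<Longrightarrow> P (vadd u v) = vadd (P u) (P v)"
    and face: "\<And>u x y. u \<in> vecs p \<Longrightarrow> x \<in> vecs n \<Longrightarrow> y \<in> vecs n \<Longrightarrow> P u = vadd x y \<Longrightarrow> x \<in> P ` vecs p"
  shows "is_pair p {u \<in> vecs p. P u \<in> T} {u \<in> vecs p. P u \<in> J}"
proof (rule is_pairI)
  note V = pair[unfolded is_pair_iff_fpair]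
  fix v assume v: "v \<in> vecs p"
  obtain x y where xy: "x \<in> T" "y \<in> J" "P v = vadd x y" using is_pair_obtain[OF pair P(2)[OF v]]
      by metis
  have "x \<in> vecs n" "y \<in> vecs n" "P v = vadd y x" using xy V vadd_commute by auto
  then have "x \<in> P ` vecs p" "y \<in> P ` vecs p"
    using face[OF v, of x y] face[OF v, of y x] xy by auto
  then obtain t s where ts: "t \<in> vecs p" "s \<in> vecs p" "x = P t" "y = P s" by auto
  then have "P v = P (vadd t s)" using xy add by simp
  then have "v = vadd t s" using inj_onD[OF P(1)] v ts by simp
  then show "\<exists>t\<in>{u \<in> vecs p. P u \<in> T}. \<exists>s\<in>{u \<in> vecs p. P u \<in> J}. v = vadd t s"
    using ts xy by blast
next
  fix t s t' s'
  assume h: "t \<in> {u \<in> vecs p. P u \<in> T}" "s \<in> {u \<in> vecs p. P u \<in> J}"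
    "t' \<in> {u \<in> vecs p. P u \<in> T}" "s' \<in> {u \<in> vecs p. P u \<in> J}" "vadd t s = vadd t' s'"
  then have "vadd (P t) (P s) = vadd (P t') (P s')" using add by (metis mem_Collect_eq)
  then have "P t = P t'" "P s = P s'" using is_pair_unique[OF pair] h by blast+
  then show "t = t' \<and> s = s'" using inj_onD[OF P(1)] h by auto
qed (use P in auto)

lemma vadd_eq_0_left: "x \<in> vecs n \<Longrightarrow> y \<in> vecs n \<Longrightarrow> vadd x y = replicate n 0 \<Longrightarrow> x = replicate n 0"
  by (rule enc_inj[of _ n]) (auto dest: arg_cong[of _ _ enc] simp: enc_vadd)

lemma vecs_append_obtain:
  assumes "v \<in> vecs (p + q)"
  obtains v1 v2 where "v1 \<in> vecs p" "v2 \<in> vecs q" "v = v1 @ v2"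
  using that[of "take p v" "drop p v"] assms by (auto simp: vecs_def)

lemma append_in_vecs: "u \<in> vecs p \<Longrightarrow> v \<in> vecs q \<Longrightarrow> u @ v \<in> vecs (p + q)"
  by (simp add: vecs_def)

text \<open>The factors are the intersections of \<open>T\<close> and \<open>J\<close> with the
  faces of \<open>S\<close> and of its complement, embedded by \<open>P\<close> and
  \<open>Q\<close>. Splitting gives the inclusion into the product, recombination the reverse
  one.\<close>

lemma splits_is_cart:
  assumes pair: "is_pair n T J" and S: "S \<subseteq> {..<n}" "S \<noteq> {}" "S \<noteq> {..<n}"
    and sp: "splits S (enc ` T) (enc ` J)"
  shows "\<exists>p q I1 J1 I2 J2. n = p + q \<and> is_pair p I1 J1 \<and> is_pair q I2 J2 \<and>
          permuted n T J (cart I1 I2) (cart J1 J2)"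
proof -
  obtain \<sigma> where \<sigma>: "\<sigma> permutes {..<n}" and \<sigma>S: "\<And>i. i < n \<Longrightarrow> \<sigma> i < card S \<longleftrightarrow> i \<in> S"
    using permutes_subset_to_initial[OF S(1)] by blast
  define p where "p = card S"
  define q where "q = n - p"
  have "finite S" using S finite_subset by blast
  then have "p < n" "p \<ge> 1" using psubset_card_mono[of "{..<n}" S] S
      by (auto simp: p_def Suc_le_eq card_gt_0_iff)
  then have pq: "n = p + q" "p \<ge> 1" "q \<ge> 1" by (auto simp: q_def)
  note \<sigma>' = \<sigma>[unfolded pq(1)]
  have restr_S: "restr S f = restr {i. \<sigma> i < p} f" "restr (- S) f = restr (- {i. \<sigma> i < p}) f"
    if "f \<in> vectors {..<n}" for f
    using that \<sigma>S by (auto simp: restr_def vectors_def p_def fun_eq_iff)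
  define P where "P u = permute_list \<sigma> (u @ replicate q 0)" for u :: "nat list"
  define Q where "Q v = permute_list \<sigma> (replicate p 0 @ v)" for v :: "nat list"
  have PV: "P u \<in> vecs n" if "u \<in> vecs p" for u
    using that by (simp add: P_def vecs_def pq)
  have QV: "Q u \<in> vecs n" if "u \<in> vecs q" for u
    using that by (simp add: Q_def vecs_def pq)
  have vadd0: "vadd (replicate k 0) (replicate k 0) = replicate k 0" for k
    by (simp add: vadd_def list_eq_iff_nth_eq)
  have P_add: "P (vadd u v) = vadd (P u) (P v)" if "u \<in> vecs p" "v \<in> vecs p" for u v
    using that permute_list_vadd[OF \<sigma>', of "u @ replicate q 0" "v @ replicate q 0"]
    by (simp add: P_def append_in_vecs vadd_append vecs_def vadd0)
  have Q_add: "Q (vadd u v) = vadd (Q u) (Q v)" if "u \<in> vecs q" "v \<in> vecs q" for u v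
    using that permute_list_vadd[OF \<sigma>', of "replicate p 0 @ u" "replicate p 0 @ v"]
    by (simp add: Q_def append_in_vecs vadd_append vecs_def vadd0)
  have PQ_add: "vadd (P u) (Q v) = permute_list \<sigma> (u @ v)" if "u \<in> vecs p" "v \<in> vecs q" for u v
  proof -
    have "vadd (u @ replicate q 0) (replicate p 0 @ v) = u @ v"
      using that vadd_0[of u p] vadd_0[of v q] by (simp add: vadd_append vecs_def vadd_commute)
    then show ?thesis
      using that permute_list_vadd[OF \<sigma>', of "u @ replicate q 0" "replicate p 0 @ v"]
      by (simp add: P_def Q_def append_in_vecs)
  qed
  have split_obtain: "\<exists>x1 x2 y1 y2. x1 \<in> vecs p \<and> x2 \<in> vecs q \<and> y1 \<in> vecs p \<and> y2 \<in> vecs q \<and>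
      x = permute_list \<sigma> (x1 @ x2) \<and> y = permute_list \<sigma> (y1 @ y2) \<and> u = vadd x1 y1 \<and> v = vadd x2 y2"
    if h: "u \<in> vecs p" "v \<in> vecs q" "x \<in> vecs n" "y \<in> vecs n" "permute_list \<sigma> (u @ v) = vadd x y"
        for u v x y
  proof -
    obtain x' y' where x': "x' \<in> vecs n" "x = permute_list \<sigma> x'"
        and y': "y' \<in> vecs n" "y = permute_list \<sigma> y'"
      using permute_list_surj[OF \<sigma>] h by metis
    obtain x1 x2 where x: "x1 \<in> vecs p" "x2 \<in> vecs q" "x' = x1 @ x2"
      using vecs_append_obtain x' pq by metis
    obtain y1 y2 where y: "y1 \<in> vecs p" "y2 \<in> vecs q" "y' = y1 @ y2"
      using vecs_append_obtain y' pq by metis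
    have "permute_list \<sigma> (u @ v) = permute_list \<sigma> (vadd x' y')"
      using h(5) x' y' permute_list_vadd[OF \<sigma>] by simp
    then have "u @ v = vadd x' y'"
      using permute_list_inj[OF \<sigma>] h x' y' by (metis append_in_vecs pq(1) vadd_in_vecs)
    then have "u @ v = vadd x1 y1 @ vadd x2 y2" using x y by (simp add: vadd_append vecs_def)
    then have "u = vadd x1 y1" "v = vadd x2 y2"
      using h x y by (auto simp: vecs_def append_eq_append_conv)
    then show ?thesis using x y x' y' by blast
  qed
  have P_face: "x \<in> P ` vecs p"
    if h: "u \<in> vecs p" "x \<in> vecs n" "y \<in> vecs n" "P u = vadd x y" for u x y
  proof -
    obtain x1 x2 y1 y2 where "x1 \<in> vecs p" "x2 \<in> vecs q" "y2 \<in> vecs q"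
      "x = permute_list \<sigma> (x1 @ x2)" "replicate q 0 = vadd x2 y2"
      using split_obtain[OF h(1) zero_in_vecs h(2,3)] h(4) by (auto simp: P_def)
    then show ?thesis using vadd_eq_0_left[of x2 q y2] by (auto simp: P_def)
  qed
  have Q_face: "x \<in> Q ` vecs q"
    if h: "u \<in> vecs q" "x \<in> vecs n" "y \<in> vecs n" "Q u = vadd x y" for u x y
  proof -
    obtain x1 x2 y1 y2 where "x1 \<in> vecs p" "x2 \<in> vecs q" "y1 \<in> vecs p"
      "x = permute_list \<sigma> (x1 @ x2)" "replicate p 0 = vadd x1 y1"
      using split_obtain[OF zero_in_vecs h(1) h(2,3)] h(4) by (auto simp: Q_def)
    then show ?thesis using vadd_eq_0_left[of x1 p y1] by (auto simp: Q_def)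
  qed
  have P_inj: "inj_on P (vecs p)"
  proof (rule inj_onI)
    fix x y assume "x \<in> vecs p" "y \<in> vecs p" "P x = P y"
    then have "x @ replicate q 0 = y @ replicate q 0"
      using permute_list_inj[OF \<sigma>'] append_in_vecs[OF _ zero_in_vecs] unfolding P_def by blast
    then show "x = y" by simp
  qed
  have Q_inj: "inj_on Q (vecs q)"
  proof (rule inj_onI)
    fix x y assume "x \<in> vecs q" "y \<in> vecs q" "Q x = Q y"
    then have "replicate p 0 @ x = replicate p 0 @ y"
      using permute_list_inj[OF \<sigma>'] append_in_vecs[OF zero_in_vecs] unfolding Q_def by blast
    then show "x = y" by simp
  qed
  have eq: "U = permute_list \<sigma> ` cart {u \<in> vecs p. P u \<in> U} {v \<in> vecs q. Q v \<in> U}"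
    if UW: "is_pair n U W" and sp: "splits S (enc ` U) (enc ` W)" for U W
  proof -
    have U: "U \<subseteq> vecs n" and fp: "fpair {..<n} (enc ` U) (enc ` W)"
      using UW is_pair_iff_fpair by auto
    have restr_PQ: "restr S (enc (permute_list \<sigma> (u @ v))) = enc (P u)"
      "restr (- S) (enc (permute_list \<sigma> (u @ v))) = enc (Q v)"
      if "u \<in> vecs p" "v \<in> vecs q" for u v
      using that restr_S[OF enc_in_vectors, of "permute_list \<sigma> (u @ v)"]
        restr_enc_permute_append[OF \<sigma>' that]
      by (simp_all add: append_in_vecs pq(1) P_def Q_def)
    show ?thesis
    proof (intro equalityI subsetI)
      fix t assume t: "t \<in> U"
      then obtain t' where t': "t' \<in> vecs n" "t = permute_list \<sigma> t'"
        using permute_list_surj[OF \<sigma>] U by (metis subsetD)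
      then obtain u v where uv: "u \<in> vecs p" "v \<in> vecs q" "t' = u @ v"
        using vecs_append_obtain pq(1) by metis
      have "enc (P u) \<in> enc ` U" "enc (Q v) \<in> enc ` U"
        using sp t restr_PQ[OF uv(1,2)] unfolding splits_def t' uv by (metis imageI)+
      then have "P u \<in> U" "Q v \<in> U" using enc_image_iff[OF U] PV QV uv by auto
      then show "t \<in> permute_list \<sigma> ` cart {u \<in> vecs p. P u \<in> U} {v \<in> vecs q. Q v \<in> U}"
        using uv t' by (auto simp: cart_def)
    next
      fix t assume "t \<in> permute_list \<sigma> ` cart {u \<in> vecs p. P u \<in> U} {v \<in> vecs q. Q v \<in> U}"
      then obtain u v
          where uv: "u \<in> vecs p" "v \<in> vecs q" "P u \<in> U" "Q v \<in> U" "t = permute_list \<sigma> (u @ v)"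
        by (auto simp: cart_def)
      have "enc (P u) = restr S (enc t)" "enc (Q v) = restr (- S) (enc t)"
        using restr_PQ uv by auto
      then have "enc (P u) + enc (Q v) \<in> enc ` U"
        using splits_recombine[OF fp sp] uv(3,4) by (metis imageI restr_in_vectors_self)
      moreover have "enc (P u) + enc (Q v) = enc t"
        using enc_vadd[OF PV QV] PQ_add uv by metis
      moreover have "t \<in> vecs n" using uv by (simp add: append_in_vecs pq(1))
      ultimately show "t \<in> U" using enc_image_iff[OF U] by simp
    qed
  qed
  have "permuted n T J (cart {u \<in> vecs p. P u \<in> T} {v \<in> vecs q. Q v \<in> T})
    (cart {u \<in> vecs p. P u \<in> J} {v \<in> vecs q. Q v \<in> J})"
    using \<sigma> eq[OF pair sp] eq[OF is_pair_swap[OF pair]] sp splits_swap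
    unfolding permuted_def by blast
  moreover have "is_pair p {u \<in> vecs p. P u \<in> T} {u \<in> vecs p. P u \<in> J}"
    using is_pair_factor[OF pair P_inj PV pq(2) P_add P_face] .
  moreover have "is_pair q {u \<in> vecs q. Q u \<in> T} {u \<in> vecs q. Q u \<in> J}"
    using is_pair_factor[OF pair Q_inj QV pq(3) Q_add Q_face] .
  ultimately show ?thesis using pq(1) by blast
qed

lemma primitive_pair_iff_fprim:
  "primitive_pair n T J \<longleftrightarrow> is_pair n T J \<and> fprim {..<n} (enc ` T) (enc ` J)"
proof -
  have "(\<exists>p q I1 J1 I2 J2. n = p + q \<and> is_pair p I1 J1 \<and> is_pair q I2 J2 \<and>
          permuted n T J (cart I1 I2) (cart J1 J2)) \<longleftrightarrow> \<not> fprim {..<n} (enc ` T) (enc ` J)"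
    if pair: "is_pair n T J"
  proof
    assume "\<not> fprim {..<n} (enc ` T) (enc ` J)"
    then show "\<exists>p q I1 J1 I2 J2. n = p + q \<and> is_pair p I1 J1 \<and> is_pair q I2 J2 \<and>
          permuted n T J (cart I1 I2) (cart J1 J2)"
      using splits_is_cart[OF pair] pair unfolding fprim_def is_pair_iff_fpair by blast
  qed (use cart_is_not_fprim in blast)
  then show ?thesis unfolding primitive_pair_def by blast
qed

section \<open>Extensions as sums of sets\<close>

definition vsum :: "nat list set \<Rightarrow> nat list set \<Rightarrow> nat list set" where
  "vsum A B = {vadd a b | a b. a \<in> A \<and> b \<in> B}"

text \<open>Over an infinite index set the sum in \<open>ms_mult\<close> would default to 0. All
  entries of a summand of \<open>v\<close> are bounded by \<open>sum_list v\<close>, so only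
  finitely many pairs occur.\<close>

lemma finite_vadd_fibre: "finite {(s, t). s \<in> vecs n \<and> t \<in> vecs n \<and> vadd s t = v}"
proof -
  have bound: "set s \<subseteq> {..sum_list v}" if "s \<in> vecs n" "t \<in> vecs n" "vadd s t = v" for s t
  proof
    fix x assume "x \<in> set s"
    then obtain i where i: "i < length s" "x = s ! i" by (metis in_set_conv_nth)
    then have "x \<le> v ! i" "i < length v" using that by (auto simp: vadd_def vecs_def)
    then show "x \<in> {..sum_list v}" using elem_le_sum_list[of i v] by simp
  qed
  have fin: "finite {xs. set xs \<subseteq> {..sum_list v} \<and> length xs = n}"
    by (rule finite_lists_length_eq) simp
  show ?thesis
  proof (rule finite_subset[OF _ finite_cartesian_product[OF fin fin]], rule subsetI)
    fix q assume "q \<in> {(s, t). s \<in> vecs n \<and> t \<in> vecs n \<and> vadd s t = v}"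
    then obtain s t where q: "q = (s, t)" "s \<in> vecs n" "t \<in> vecs n" "vadd s t = v" by auto
    then show "q \<in> {xs. set xs \<subseteq> {..sum_list v} \<and> length xs = n} \<times>
      {xs. set xs \<subseteq> {..sum_list v} \<and> length xs = n}"
      using bound[of s t] bound[of t s] vadd_commute[of t s] by (simp add: vecs_def)
  qed
qed

lemma ms_mult_nonzero_iff:
  assumes "A \<subseteq> vecs n" "B \<subseteq> vecs n"
  shows "ms_mult n (series_of A) (series_of B) v \<noteq> 0 \<longleftrightarrow> v \<in> vsum A B"
proof -
  have "ms_mult n (series_of A) (series_of B) v = 0 \<longleftrightarrow>
    (\<forall>(s, t) \<in> {(s, t). s \<in> vecs n \<and> t \<in> vecs n \<and> vadd s t = v}. series_of A s * series_of B t = 0)"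
    unfolding ms_mult_def by (subst sum_eq_0_iff[OF finite_vadd_fibre]) (simp add: case_prod_beta)
  also have "\<dots> \<longleftrightarrow> v \<notin> vsum A B"
    using assms by (auto simp: series_of_def vsum_def split: if_splits)
  finally show ?thesis by simp
qed

lemma series_of_vsum_left:
  assumes "A \<subseteq> vecs n" "B \<subseteq> vecs n" "series_of X = ms_mult n (series_of A) (series_of B)"
  shows "X = vsum A B"
proof -
  have "v \<in> X \<longleftrightarrow> series_of X v \<noteq> 0" for v by (simp add: series_of_def)
  then show ?thesis using ms_mult_nonzero_iff[OF assms(1,2)] assms(3) by auto
qed

text \<open>A coefficient of the product counts representations; when these are unique it is 0 or 1,
  so the product is again the series of a set.\<close>

lemma series_of_vsum:
  assumes V: "A \<subseteq> vecs n" "B \<subseteq> vecs n"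
    and uniq: "\<And>a b a' b'. \<lbrakk>a \<in> A; b \<in> B; a' \<in> A; b' \<in> B; vadd a b = vadd a' b'\<rbrakk> \<Longrightarrow> a = a' \<and> b = b'"
  shows "series_of (vsum A B) = ms_mult n (series_of A) (series_of B)"
proof
  fix v
  show "series_of (vsum A B) v = ms_mult n (series_of A) (series_of B) v"
  proof (cases "v \<in> vsum A B")
    case True
    then obtain a b where ab: "a \<in> A" "b \<in> B" "v = vadd a b" by (auto simp: vsum_def)
    have mem: "(a, b) \<in> {(s, t). s \<in> vecs n \<and> t \<in> vecs n \<and> vadd s t = v}" using ab V by auto
    have other: "(\<lambda>(s, t). series_of A s * series_of B t) q = 0"
      if "q \<in> {(s, t). s \<in> vecs n \<and> t \<in> vecs n \<and> vadd s t = v} - {(a, b)}" for q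
      using that uniq[OF _ _ ab(1,2)] ab(3) by (auto simp: series_of_def split: if_splits)
    have "ms_mult n (series_of A) (series_of B) v = (\<lambda>(s, t). series_of A s * series_of B t) (a, b)"
      unfolding ms_mult_def
      by (subst sum.remove[OF finite_vadd_fibre mem]) (use other in \<open>simp add: sum.neutral\<close>)
    then show ?thesis using ab True by (simp add: series_of_def)
  next
    case False
    then show ?thesis using ms_mult_nonzero_iff[OF V, of v] by (simp add: series_of_def)
  qed
qed

lemma ms_subst_series_of:
  assumes "inj_on \<phi> (vecs n)" "A \<subseteq> vecs n"
  shows "ms_subst n \<phi> (series_of A) = series_of (\<phi> ` A)"
proof
  fix w
  show "ms_subst n \<phi> (series_of A) w = series_of (\<phi> ` A) w"
  proof (cases "\<exists>v\<in>vecs n. \<phi> v = w")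
    case True
    then obtain v where v: "v \<in> vecs n" "\<phi> v = w" by blast
    then have "{u \<in> vecs n. \<phi> u = w} = {v}" using inj_onD[OF assms(1)] by auto
    moreover have "w \<in> \<phi> ` A \<longleftrightarrow> v \<in> A"
      using v assms by (metis image_eqI inj_on_image_mem_iff)
    ultimately show ?thesis by (simp add: ms_subst_def series_of_def)
  next
    case False
    then have "{u \<in> vecs n. \<phi> u = w} = {}" "w \<notin> \<phi> ` A" using assms(2) by auto
    then show ?thesis by (simp only: ms_subst_def series_of_def) simp
  qed
qed

section \<open>Substitutions as maps of exponent vectors\<close>

definition pad :: "nat \<Rightarrow> nat \<Rightarrow> nat \<Rightarrow> nat list \<Rightarrow> nat list" where
  "pad n j m v = replicate j 0 @ v @ replicate (n - j - m) 0"

definition subst_vec :: "nat \<Rightarrow> nat list \<Rightarrow> nat list \<Rightarrow> nat list" where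
  "subst_vec j a v = take j v @ map (\<lambda>c. v ! j * c) a @ drop (Suc j) v"

text \<open>Common form of both extension types: the first has \<open>a = [N]\<close> and
  \<open>C\<close> a set of one-entry vectors, the second has \<open>C\<close> equal to
  \<open>L_set a\<close> or to the zero vector alone.\<close>

definition block_ext :: "nat \<Rightarrow> nat \<Rightarrow> nat list \<Rightarrow> nat list set \<Rightarrow> nat list set \<Rightarrow> nat list set" where
  "block_ext n j a C T = vsum (pad (n + length a - 1) j (length a) ` C) (subst_vec j a ` T)"

lemma pad_inj: "inj_on (pad n j m) (vecs m)"
  by (auto simp: inj_on_def pad_def)

lemma subst_vec_inj:
  assumes "j < n" "a \<noteq> []" "\<forall>c\<in>set a. c \<noteq> 0"
  shows "inj_on (subst_vec j a) (vecs n)"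
proof (rule inj_onI)
  fix u v assume uv: "u \<in> vecs n" "v \<in> vecs n" "subst_vec j a u = subst_vec j a v"
  then have eq: "take j u = take j v" "map (\<lambda>c. u ! j * c) a = map (\<lambda>c. v ! j * c) a"
    "drop (Suc j) u = drop (Suc j) v"
    using assms by (auto simp: subst_vec_def vecs_def)
  obtain c where "c \<in> set a" using assms(2) by (cases a) auto
  then have "u ! j * c = v ! j * c" "c \<noteq> 0" using eq(2) assms(3) by auto
  then have "u ! j = v ! j" by simp
  then show "u = v"
    using eq(1,3) uv(1,2) assms(1) id_take_nth_drop[of j u] id_take_nth_drop[of j v]
    by (simp add: vecs_def)
qed

lemma in_vars_series_of: "C \<subseteq> vecs m \<Longrightarrow> in_vars n j m (series_of C) = series_of (pad n j m ` C)"
  using ms_subst_series_of[OF pad_inj] unfolding in_vars_def pad_def by blast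

lemma subst_var_series_of:
  assumes "j < n" "a \<noteq> []" "\<forall>c\<in>set a. c \<noteq> 0" "T \<subseteq> vecs n"
  shows "subst_var n j a (series_of T) = series_of (subst_vec j a ` T)"
  using ms_subst_series_of[OF subst_vec_inj[OF assms(1-3)] assms(4)]
  unfolding subst_var_def subst_vec_def .

lemma pad_in_vecs: "j < n \<Longrightarrow> c \<in> vecs m \<Longrightarrow> m \<ge> 1 \<Longrightarrow> pad (n + m - 1) j m c \<in> vecs (n + m - 1)"
  by (auto simp: pad_def vecs_def)

lemma subst_vec_in_vecs: "j < n \<Longrightarrow> v \<in> vecs n \<Longrightarrow> subst_vec j a v \<in> vecs (n + length a - 1)"
  by (auto simp: subst_vec_def vecs_def)

lemma block_ext_in_vecs:
  assumes "j < n" "a \<noteq> []" "C \<subseteq> vecs (length a)" "T \<subseteq> vecs n"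
  shows "block_ext n j a C T \<subseteq> vecs (n + length a - 1)"
proof -
  have "length a \<ge> 1" using assms(2) by (cases a) auto
  then have "pad (n + length a - 1) j (length a) c \<in> vecs (n + length a - 1)" if "c \<in> C" for c
    using pad_in_vecs[OF assms(1)] assms(3) that by blast
  moreover have "subst_vec j a t \<in> vecs (n + length a - 1)" if "t \<in> T" for t
    using subst_vec_in_vecs[OF assms(1)] assms(4) that by blast
  ultimately show ?thesis by (auto simp: block_ext_def vsum_def)
qed

lemma block_ext_of_series:
  assumes "j < n" "a \<noteq> []" "\<forall>c\<in>set a. c \<noteq> 0" "C \<subseteq> vecs (length a)" "T \<subseteq> vecs n"
    and "n' = n + length a - 1" and m: "m = length a"
    and "series_of X = ms_mult n' (in_vars n' j m (series_of C)) (subst_var n j a (series_of T))"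
  shows "X = block_ext n j a C T"
proof -
  have "length a \<ge> 1" using assms(2) by (cases a) auto
  then have "pad n' j m ` C \<subseteq> vecs n'" "subst_vec j a ` T \<subseteq> vecs n'"
    using pad_in_vecs[OF assms(1)] subst_vec_in_vecs[OF assms(1)] assms(4-7) by blast+
  then show ?thesis
    using series_of_vsum_left assms(8) in_vars_series_of[of C m n' j] subst_var_series_of[OF assms(1-3,5)] assms(4,6,7)
    by (simp add: block_ext_def)
qed

lemma ms_power_01:
  assumes "A \<subseteq> vecs n"
  shows "ms_power n (series_of A) 0 = series_of {replicate n 0}"
    and "ms_power n (series_of A) 1 = series_of A"
proof -
  show "ms_power n (series_of A) 0 = series_of {replicate n 0}"
    by (simp add: ms_power_def ms_one_def)
  have "vadd a (replicate n 0) = a" if "a \<in> A" for a using that assms vadd_0 by blast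
  then have "vsum A {replicate n 0} = A" "\<And>a b. a \<in> A \<Longrightarrow> b \<in> A \<Longrightarrow> vadd a (replicate n 0) = vadd b (replicate n 0) \<Longrightarrow> a = b"
    by (force simp: vsum_def)+
  then have "series_of A = ms_mult n (series_of A) (series_of {replicate n 0})"
    using series_of_vsum[OF assms, of "{replicate n 0}"] by simp
  then show "ms_power n (series_of A) 1 = series_of A"
    by (simp add: ms_power_def ms_one_def)
qed

text \<open>For \<open>k\<close> at most 1, the set whose series is the \<open>k\<close>-th power of
  that of \<open>L_set a\<close>; it eliminates \<open>ms_power\<close>.\<close>

definition L_power :: "nat list \<Rightarrow> nat \<Rightarrow> nat list set" where
  "L_power a k = (if k = 0 then {replicate (length a) 0} else L_set a)"

lemma L_set_in_vecs: "L_set a \<subseteq> vecs (length a)"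
  by (auto simp: L_set_def)

lemma L_power_in_vecs: "L_power a k \<subseteq> vecs (length a)"
  using L_set_in_vecs by (auto simp: L_power_def)

lemma ms_power_in_vars:
  assumes "j < n" "a \<noteq> []" "k \<in> {0, 1}" "n' = n + length a - 1" "m = length a"
  shows "ms_power n' (in_vars n' j m (series_of (L_set a))) k = in_vars n' j m (series_of (L_power a k))"
proof -
  have m1: "m \<ge> 1" using assms(2,5) by (cases a) auto
  have V: "pad n' j m ` L_set a \<subseteq> vecs n'"
    using pad_in_vecs[OF assms(1) _ m1] L_set_in_vecs[of a] assms(4,5) by blast
  have "pad n' j m (replicate m 0) = replicate n' 0"
    using assms(1,4,5) m1 by (auto simp: pad_def replicate_add[symmetric])
  then show ?thesis
    using ms_power_01[OF V] in_vars_series_of[OF L_set_in_vecs[of a], of n' j]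
      in_vars_series_of[of "{replicate m 0}" m n' j] assms(3,5)
    by (auto simp: L_power_def)
qed

lemma mem_L_set_iff:
  assumes "length v = length a"
  shows "v \<in> L_set a \<longleftrightarrow> (\<exists>i<length a. v ! i < a ! i)"
proof -
  have "(\<exists>u\<in>vecs (length a). v = vadd u a) \<longleftrightarrow> (\<forall>i<length a. a ! i \<le> v ! i)"
  proof
    assume "\<forall>i<length a. a ! i \<le> v ! i"
    then have "v = vadd (map2 (-) v a) a"
      using assms by (auto simp: vadd_def list_eq_iff_nth_eq)
    moreover have "map2 (-) v a \<in> vecs (length a)" using assms by (simp add: vecs_def)
    ultimately show "\<exists>u\<in>vecs (length a). v = vadd u a" by blast
  qed (auto simp: vadd_def vecs_def)
  then show ?thesis using assms by (auto simp: L_set_def vecs_def not_less)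
qed

lemma first_type_ext_imp_block:
  assumes "first_type_ext n T J n' T' J'"
  obtains j N C D where "j < n" "N \<ge> 2" "n' = n" "C \<subseteq> {0..<N}" "D \<subseteq> {0..<N}" "0 \<in> C" "0 \<in> D"
    "T' = block_ext n j [N] ((\<lambda>c. [c]) ` C) T" "J' = block_ext n j [N] ((\<lambda>d. [d]) ` D) J"
proof -
  obtain j N C D where h: "j < n" "N \<ge> 2" "C \<subseteq> {0..<N}" "D \<subseteq> {0..<N}"
    and sum: "{c + d | c d. c \<in> C \<and> d \<in> D} = {0..<N}" and n': "n' = n" and pair: "is_pair n T J"
    and T': "series_of T' = ms_mult n' (in_vars n' j 1 (series_of ((\<lambda>c. [c]) ` C))) (subst_var n j [N] (series_of T))"
    and J': "series_of J' = ms_mult n' (in_vars n' j 1 (series_of ((\<lambda>d. [d]) ` D))) (subst_var n j [N] (series_of J))"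
    using assms unfolding first_type_ext_def by (elim conjE exE) (rule that; assumption)
  have "0 \<in> {c + d | c d. c \<in> C \<and> d \<in> D}" using sum h by simp
  then have "0 \<in> C" "0 \<in> D" by auto
  moreover have V: "T \<subseteq> vecs n" "J \<subseteq> vecs n" using pair by (auto simp: is_pair_def)
  have "T' = block_ext n j [N] ((\<lambda>c. [c]) ` C) T"
    by (rule block_ext_of_series[OF h(1) _ _ _ V(1) _ _ T']) (use h n' in \<open>auto simp: vecs_def\<close>)
  moreover have "J' = block_ext n j [N] ((\<lambda>d. [d]) ` D) J"
    by (rule block_ext_of_series[OF h(1) _ _ _ V(2) _ _ J']) (use h n' in \<open>auto simp: vecs_def\<close>)
  ultimately show ?thesis using that h n' by blast
qed

lemma second_type_ext_iff_series:
  "second_type_ext \<delta> n T J n' T' J' \<longleftrightarrow> is_pair n T J \<and> \<delta> \<in> {0, 1} \<and>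
    (\<exists>j a. j < n \<and> length a \<ge> 2 \<and> (\<forall>c\<in>set a. c \<noteq> 0) \<and> n' = n + length a - 1 \<and>
      series_of T' = ms_mult n' (in_vars n' j (length a) (series_of (L_power a \<delta>))) (subst_var n j a (series_of T)) \<and>
      series_of J' = ms_mult n' (in_vars n' j (length a) (series_of (L_power a (1 - \<delta>)))) (subst_var n j a (series_of J)))"
proof -
  have "ms_power n' (in_vars n' j (length a) (series_of (L_set a))) k = in_vars n' j (length a) (series_of (L_power a k))"
    if "j < n" "length a \<ge> 2" "n' = n + length a - 1" "k \<in> {0, 1}" for j a k
    using ms_power_in_vars[OF that(1) _ that(4,3)] that(2) by fastforce
  note pw = this
  have "1 - \<delta> \<in> {0, 1}" by auto
  note pw = pw[OF _ _ _ this] pw[of _ _ \<delta>]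
  show ?thesis (is "_ \<longleftrightarrow> ?R")
  proof
    assume "second_type_ext \<delta> n T J n' T' J'"
    then obtain j m a where h: "is_pair n T J" "\<delta> \<in> {0, 1}" "j < n" "m \<ge> 2" "length a = m"
      "\<forall>c\<in>set a. c \<noteq> 0" "n' = n + m - 1"
      "series_of T' = ms_mult n' (ms_power n' (in_vars n' j m (series_of (L_set a))) \<delta>)
         (subst_var n j a (series_of T))"
      "series_of J' = ms_mult n' (ms_power n' (in_vars n' j m (series_of (L_set a))) (1 - \<delta>))
         (subst_var n j a (series_of J))"
      unfolding second_type_ext_def by (elim conjE exE) (rule that; assumption)
    then show ?R
      using pw[of j a] by (intro conjI exI[of _ j] exI[of _ a]) simp_all
  next
    assume ?R
    then obtain j a where h: "is_pair n T J" "\<delta> \<in> {0, 1}" "j < n" "length a \<ge> 2"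
      "\<forall>c\<in>set a. c \<noteq> 0" "n' = n + length a - 1"
      "series_of T' = ms_mult n' (in_vars n' j (length a) (series_of (L_power a \<delta>)))
         (subst_var n j a (series_of T))"
      "series_of J' = ms_mult n' (in_vars n' j (length a) (series_of (L_power a (1 - \<delta>))))
         (subst_var n j a (series_of J))"
      by (elim conjE exE) (rule that; assumption)
    then show "second_type_ext \<delta> n T J n' T' J'"
      unfolding second_type_ext_def
      using pw[of j a] by (intro conjI exI[of _ j] exI[of _ "length a"] exI[of _ a]) simp_all
  qed
qed

lemma second_type_ext_imp_block:
  assumes "second_type_ext \<delta> n T J n' T' J'"
  obtains j a where "j < n" "length a \<ge> 2" "\<forall>c\<in>set a. c \<noteq> 0" "n' = n + length a - 1"
    "T' = block_ext n j a (L_power a \<delta>) T" "J' = block_ext n j a (L_power a (1 - \<delta>)) J"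
proof -
  obtain j a where h: "j < n" "length a \<ge> 2" "\<forall>c\<in>set a. c \<noteq> 0" "n' = n + length a - 1"
    and T': "series_of T' = ms_mult n' (in_vars n' j (length a) (series_of (L_power a \<delta>))) (subst_var n j a (series_of T))"
    and J': "series_of J' = ms_mult n' (in_vars n' j (length a) (series_of (L_power a (1 - \<delta>)))) (subst_var n j a (series_of J))"
    and pair: "is_pair n T J"
    using assms unfolding second_type_ext_iff_series by blast
  have V: "T \<subseteq> vecs n" "J \<subseteq> vecs n" using pair by (auto simp: is_pair_def)
  have a: "a \<noteq> []" using h(2) by auto
  show ?thesis
    using that[OF h] block_ext_of_series[OF h(1) a h(3) L_power_in_vecs V(1) h(4) refl T']
      block_ext_of_series[OF h(1) a h(3) L_power_in_vecs V(2) h(4) refl J'] by blast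
qed

text \<open>The map \<open>p\<close> of the stretching before any permutation: each new variable is
  sent to the old one it comes from.\<close>

definition block_index :: "nat \<Rightarrow> nat \<Rightarrow> nat \<Rightarrow> nat" where
  "block_index j m i = (if i < j then i else if i < j + m then j else i - (m - 1))"

definition block_weight :: "nat \<Rightarrow> nat list \<Rightarrow> nat \<Rightarrow> nat" where
  "block_weight j a i = (if j \<le> i \<and> i < j + length a then a ! (i - j) else 1)"

lemma enc_pad:
  assumes "c \<in> vecs m" "j + m \<le> n"
  shows "enc (pad n j m c) i = (if j \<le> i \<and> i < j + m then c ! (i - j) else 0)"
  using assms by (auto simp: enc_def pad_def vecs_def nth_append)

lemma enc_subst_vec:
  assumes t: "t \<in> vecs n" and j: "j < n" and a: "a \<noteq> []"
  shows "enc (subst_vec j a t) i =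
    (if i < n + length a - 1 then block_weight j a i * enc t (block_index j (length a) i) else 0)"
proof -
  have len: "length (subst_vec j a t) = n + length a - 1" "length t = n"
    using subst_vec_in_vecs[OF j t, of a] t by (auto simp: vecs_def)
  show ?thesis
  proof (cases "i < n + length a - 1")
    case True
    consider "i < j" | "j \<le> i" "i < j + length a" | "j + length a \<le> i" by linarith
    then have "subst_vec j a t ! i = block_weight j a i * enc t (block_index j (length a) i)"
    proof cases
      case 3
      then have "i - (j + length a) + Suc j = i - (length a - 1)" "i - (length a - 1) < n"
        using a True by (cases a; simp)+
      then show ?thesis
        using 3 len j a
            by (auto simp: subst_vec_def nth_append block_weight_def block_index_def enc_def)
    qed (use len j in \<open>auto simp: subst_vec_def nth_append block_weight_def block_index_def enc_def\<close>)
    then show ?thesis using True len by (simp add: enc_def)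
  qed (simp add: enc_def len)
qed

text \<open>A list-level block extension followed by a permutation of coordinates. As position
  \<open>i\<close> of the permuted list holds entry \<open>\<pi> i\<close>, index map and weights
  are composed with \<open>\<pi>\<close>, and the block becomes its preimage
  \<open>fibre\<close>.\<close>

locale block =
  fixes n j :: nat and a :: "nat list" and n' :: nat and \<pi> :: "nat \<Rightarrow> nat"
  assumes j: "j < n" and a: "a \<noteq> []" and a_pos: "\<forall>c\<in>set a. c \<noteq> 0"
    and n': "n' = n + length a - 1" and \<pi>: "\<pi> permutes {..<n'}"
begin

abbreviation "fibre \<equiv> {i. i < n' \<and> j \<le> \<pi> i \<and> \<pi> i < j + length a}"

lemma length_a: "length a \<ge> 1" and block_le: "j + length a \<le> n'"
  using a j n' by (cases a; simp)+

lemma \<pi>_less: "\<pi> i < n' \<longleftrightarrow> i < n'"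
  using permutes_in_image[OF \<pi>, of i] by simp

lemma block_index_image: "block_index j (length a) ` {..<n'} = {..<n}"
proof (intro equalityI subsetI)
  fix i assume "i \<in> block_index j (length a) ` {..<n'}"
  then show "i \<in> {..<n}" using j n' length_a by (auto simp: block_index_def split: if_splits)
next
  fix i assume i: "i \<in> {..<n}"
  have "i = block_index j (length a) (if i \<le> j then i else i + (length a - 1))"
    using length_a by (auto simp: block_index_def)
  moreover have "(if i \<le> j then i else i + (length a - 1)) < n'"
    using i length_a n' by auto
  ultimately show "i \<in> block_index j (length a) ` {..<n'}" by blast
qed

sublocale stretching "{..<n}" "{..<n'}" "block_index j (length a) \<circ> \<pi>" "block_weight j a \<circ> \<pi>" j fibre
proof
  show "(block_index j (length a) \<circ> \<pi>) ` {..<n'} = {..<n}"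
    using block_index_image permutes_image[OF \<pi>] by (metis image_comp)
  show "fibre = {i \<in> {..<n'}. (block_index j (length a) \<circ> \<pi>) i = j}"
    using length_a by (auto simp: block_index_def split: if_splits)
  show "inj_on (block_index j (length a) \<circ> \<pi>) ({..<n'} - fibre)"
  proof (rule inj_onI)
    fix x y
    assume "x \<in> {..<n'} - fibre" "y \<in> {..<n'} - fibre"
      "(block_index j (length a) \<circ> \<pi>) x = (block_index j (length a) \<circ> \<pi>) y"
    then have "\<pi> x = \<pi> y" using length_a by (auto simp: block_index_def split: if_splits)
    then show "x = y" using permutes_inj[OF \<pi>] by (simp add: inj_eq)
  qed
  show "0 < (block_weight j a \<circ> \<pi>) i" if "i \<in> {..<n'}" for i
    using a_pos by (auto simp: block_weight_def)
qed (use j in \<open>auto simp: block_weight_def\<close>)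

definition block_vec :: "nat list \<Rightarrow> nat \<Rightarrow> nat" where
  "block_vec c = enc (pad n' j (length a) c) \<circ> \<pi>"

lemma block_vec_eq:
  "c \<in> vecs (length a) \<Longrightarrow> block_vec c i = (if i \<in> fibre then c ! (\<pi> i - j) else 0)"
  using block_le \<pi>_less[of i] by (auto simp: block_vec_def enc_pad)

lemma block_vec_0: "block_vec (replicate (length a) 0) = 0"
  by (auto simp: block_vec_eq fun_eq_iff)

lemma pad_in: "c \<in> vecs (length a) \<Longrightarrow> pad n' j (length a) c \<in> vecs n'"
  using pad_in_vecs[OF j _ length_a] n' by simp

lemma subst_in: "t \<in> vecs n \<Longrightarrow> subst_vec j a t \<in> vecs n'"
  using subst_vec_in_vecs[OF j] n' by simp

lemma enc_block:
  assumes c: "c \<in> vecs (length a)" and t: "t \<in> vecs n"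
  shows "enc (permute_list \<pi> (vadd (pad n' j (length a) c) (subst_vec j a t))) =
    block_vec c + stretch (enc t)"
proof -
  have eq: "enc (subst_vec j a t) \<circ> \<pi> = stretch (enc t)"
  proof
    fix i
    show "(enc (subst_vec j a t) \<circ> \<pi>) i = stretch (enc t) i"
      using \<pi>_less[of i] enc_subst_vec[OF t j a, of "\<pi> i", folded n'] by (simp add: stretch_def)
  qed
  show ?thesis
    unfolding enc_permute_list[OF \<pi> vadd_in_vecs[OF pad_in[OF c] subst_in[OF t]]]
      enc_vadd[OF pad_in[OF c] subst_in[OF t]] block_vec_def eq[symmetric]
    by (simp add: fun_eq_iff)
qed

lemma enc_block_ext:
  assumes "C \<subseteq> vecs (length a)" "T \<subseteq> vecs n"
  shows "enc ` permute_list \<pi> ` block_ext n j a C T = extend (block_vec ` C) (enc ` T)"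
proof (intro equalityI subsetI)
  fix f assume "f \<in> enc ` permute_list \<pi> ` block_ext n j a C T"
  then obtain c t where "c \<in> C" "t \<in> T"
    "f = enc (permute_list \<pi> (vadd (pad n' j (length a) c) (subst_vec j a t)))"
    by (auto simp: block_ext_def vsum_def n')
  then show "f \<in> extend (block_vec ` C) (enc ` T)"
    using enc_block[of c t] assms by (auto simp: extend_def)
next
  fix f assume "f \<in> extend (block_vec ` C) (enc ` T)"
  then obtain c t where ct: "c \<in> C" "t \<in> T" "f = block_vec c + stretch (enc t)"
    by (auto simp: extend_def)
  then have "f = enc (permute_list \<pi> (vadd (pad n' j (length a) c) (subst_vec j a t)))"
    using enc_block[of c t] assms ct(1,2) by (metis subsetD)
  moreover have "vadd (pad n' j (length a) c) (subst_vec j a t) \<in> block_ext n j a C T"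
    using ct by (auto simp: block_ext_def vsum_def n')
  ultimately show "f \<in> enc ` permute_list \<pi> ` block_ext n j a C T" by blast
qed

lemma block_vec_L_set: "block_vec ` L_set a = L"
proof (intro equalityI subsetI)
  fix l assume "l \<in> block_vec ` L_set a"
  then obtain c where c: "c \<in> L_set a" "l = block_vec c" by auto
  then have cV: "c \<in> vecs (length a)" using L_set_in_vecs by blast
  then obtain k where k: "k < length a" "c ! k < a ! k"
    using c mem_L_set_iff by (auto simp: vecs_def)
  obtain i where i: "\<pi> i = j + k" using permutes_surj[OF \<pi>] by (metis surjD)
  then have "i \<in> fibre" using \<pi>_less[of i] block_le k by simp
  moreover from this have "l i < (block_weight j a \<circ> \<pi>) i"
    using i k c block_vec_eq[OF cV, of i] by (simp add: block_weight_def)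
  moreover have "l \<in> vectors fibre"
    using c block_vec_eq[OF cV] by (auto simp: vectors_def)
  ultimately show "l \<in> L" unfolding L_def by blast
next
  fix l assume l: "l \<in> L"
  define c where "c = map (\<lambda>k. l (inv \<pi> (j + k))) [0..<length a]"
  have cV: "c \<in> vecs (length a)" by (simp add: c_def vecs_def)
  have inv: "inv \<pi> (\<pi> i) = i" for i using permutes_inverses(2)[OF \<pi>] .
  have lc: "l i = c ! (\<pi> i - j)" if "i \<in> fibre" for i
  proof -
    have "\<pi> i - j < length a" "j + (\<pi> i - j) = \<pi> i" using that by auto
    then show ?thesis using inv[of i] by (simp add: c_def)
  qed
  have "l = block_vec c"
    using l lc block_vec_eq[OF cV] by (auto simp: L_def vectors_def fun_eq_iff)
  moreover obtain i where i: "i \<in> fibre" "l i < (block_weight j a \<circ> \<pi>) i"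
    using l by (auto simp: L_def)
  have "\<pi> i - j < length a" "c ! (\<pi> i - j) < a ! (\<pi> i - j)"
    using i lc[OF i(1)] by (auto simp: block_weight_def)
  then have "c \<in> L_set a" using mem_L_set_iff[of c a] cV by (auto simp: vecs_def)
  ultimately show "l \<in> block_vec ` L_set a" by blast
qed

lemma block_vec_inj: "inj_on block_vec (vecs (length a))"
proof (rule inj_onI)
  fix c d assume cd: "c \<in> vecs (length a)" "d \<in> vecs (length a)" "block_vec c = block_vec d"
  show "c = d"
  proof (rule nth_equalityI)
    fix k assume k: "k < length c"
    obtain i where i: "\<pi> i = j + k" using permutes_surj[OF \<pi>] by (metis surjD)
    then have "i \<in> fibre" using \<pi>_less[of i] block_le k cd(1) by (simp add: vecs_def)
    then show "c ! k = d ! k"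
      using fun_cong[OF cd(3), of i] i block_vec_eq[OF cd(1)] block_vec_eq[OF cd(2)] by simp
  qed (use cd in \<open>simp add: vecs_def\<close>)
qed

text \<open>As \<open>C\<close> lies in \<open>L_set a\<close>, unique division with remainder gives
  unique representations, so the product of the two series has only coefficients 0 and 1.\<close>

lemma series_of_block_ext:
  assumes C: "C \<subseteq> L_set a" and T: "T \<subseteq> vecs n"
  shows "series_of (block_ext n j a C T) =
    ms_mult n' (in_vars n' j (length a) (series_of C)) (subst_var n j a (series_of T))"
proof -
  have CV: "C \<subseteq> vecs (length a)" using C L_set_in_vecs by blast
  have "series_of (vsum (pad n' j (length a) ` C) (subst_vec j a ` T)) =
    ms_mult n' (series_of (pad n' j (length a) ` C)) (series_of (subst_vec j a ` T))"
  proof (rule series_of_vsum)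
    show "pad n' j (length a) ` C \<subseteq> vecs n'" "subst_vec j a ` T \<subseteq> vecs n'"
      using pad_in subst_in CV T by blast+
    fix x y x' y'
    assume "x \<in> pad n' j (length a) ` C" "y \<in> subst_vec j a ` T"
      "x' \<in> pad n' j (length a) ` C" "y' \<in> subst_vec j a ` T" and eq: "vadd x y = vadd x' y'"
    then obtain c t c' t' where c: "c \<in> C" "t \<in> T" "x = pad n' j (length a) c" "y = subst_vec j a t"
      and c': "c' \<in> C" "t' \<in> T" "x' = pad n' j (length a) c'" "y' = subst_vec j a t'"
      by blast
    have cV: "c \<in> vecs (length a)" "t \<in> vecs n" "c' \<in> vecs (length a)" "t' \<in> vecs n"
      using c c' CV T by auto
    have eq': "block_vec c + stretch (enc t) = block_vec c' + stretch (enc t')"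
      using eq enc_block[of c t] enc_block[of c' t'] cV c c' by metis
    have "block_vec c \<in> L" "block_vec c' \<in> L" using block_vec_L_set C c c' by blast+
    note L_stretch_unique[OF this enc_in_vectors[OF cV(2)] enc_in_vectors[OF cV(4)] eq']
    then have "c = c'" "t = t'" using inj_onD[OF block_vec_inj] enc_inj cV by blast+
    then show "x = x' \<and> y = y'" using c c' by simp
  qed
  then show ?thesis
    using in_vars_series_of[OF CV] subst_var_series_of[OF j a a_pos T] n'
        by (simp add: block_ext_def)
qed

end

section \<open>Primitive pairs and legal steps\<close>

lemma enc_image_eq_iff:
  assumes "A \<subseteq> vecs n" "B \<subseteq> vecs n" "enc ` A = enc ` B"
  shows "A = B"
  using assms enc_image_iff by (metis image_eqI subset_antisym subset_iff)

lemma enc_vecs: "enc ` vecs n = vectors {..<n}"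
  using enc_dec enc_in_vectors
  by (metis (no_types, lifting) dec_in_vecs image_eqI image_subsetI subsetI subset_antisym)

lemma second_type_ext_swap:
  assumes "second_type_ext \<delta> n T J n' T' J'"
  shows "second_type_ext (1 - \<delta>) n J T n' J' T'"
proof -
  obtain j a where h: "is_pair n T J" "\<delta> \<in> {0, 1}" "j < n" "length a \<ge> 2"
    "\<forall>c\<in>set a. c \<noteq> 0" "n' = n + length a - 1"
    "series_of T' = ms_mult n' (in_vars n' j (length a) (series_of (L_power a \<delta>)))
       (subst_var n j a (series_of T))"
    "series_of J' = ms_mult n' (in_vars n' j (length a) (series_of (L_power a (1 - \<delta>))))
       (subst_var n j a (series_of J))"
    using assms unfolding second_type_ext_iff_series by (elim conjE exE) (rule that; assumption)
  have "1 - (1 - \<delta>) = \<delta>" "1 - \<delta> \<in> {0, 1}" using h(2) by auto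
  then show ?thesis
    unfolding second_type_ext_iff_series using h is_pair_swap
    by (intro conjI exI[of _ j] exI[of _ a]) simp_all
qed

lemma first_type_ext_swap: "first_type_ext n T J n' T' J' \<Longrightarrow> first_type_ext n J T n' J' T'"
proof -
  have *: "(\<forall>k\<in>X. \<exists>!p. p \<in> D \<times> C \<and> fst p + snd p = k)"
    if "\<forall>k\<in>X. \<exists>!p. p \<in> C \<times> D \<and> fst p + snd p = k" for X and C D :: "nat set"
  proof
    fix k assume "k \<in> X"
    then have "\<exists>!p. p \<in> C \<times> D \<and> fst p + snd p = k" using that by blast
    then show "\<exists>!p. p \<in> D \<times> C \<and> fst p + snd p = k"
      unfolding ex1_pair[where P = "\<lambda>t s. t + s = k"] by (metis add.commute)
  qed
  have **: "{c + d | c d. c \<in> C \<and> d \<in> D} = {c + d | c d. c \<in> D \<and> d \<in> C}" for C D :: "nat set"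
    by (metis (no_types, opaque_lifting) add.commute)
  assume "first_type_ext n T J n' T' J'"
  then obtain j N C D where h: "is_pair n T J" "n' = n" "j < n" "N \<ge> 2" "C \<subseteq> {0..<N}" "D \<subseteq> {0..<N}"
    "\<forall>k\<in>{0..<N}. \<exists>!p. p \<in> C \<times> D \<and> fst p + snd p = k"
    "{c + d | c d. c \<in> C \<and> d \<in> D} = {0..<N}"
    "series_of T' = ms_mult n' (in_vars n' j 1 (series_of ((\<lambda>c. [c]) ` C))) (subst_var n j [N] (series_of T))"
    "series_of J' = ms_mult n' (in_vars n' j 1 (series_of ((\<lambda>d. [d]) ` D))) (subst_var n j [N] (series_of J))"
    unfolding first_type_ext_def by (elim conjE exE) (rule that; assumption)
  have "{c + d | c d. c \<in> D \<and> d \<in> C} = {0..<N}" using h(8) ** by metis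
  then have "\<exists>j N D C. j < n \<and> N \<ge> 2 \<and> D \<subseteq> {0..<N} \<and> C \<subseteq> {0..<N} \<and>
        (\<forall>k\<in>{0..<N}. \<exists>!p. p \<in> D \<times> C \<and> fst p + snd p = k) \<and>
        {c + d | c d. c \<in> D \<and> d \<in> C} = {0..<N} \<and>
        series_of J' = ms_mult n' (in_vars n' j 1 (series_of ((\<lambda>d. [d]) ` D)))
                                  (subst_var n j [N] (series_of J)) \<and>
        series_of T' = ms_mult n' (in_vars n' j 1 (series_of ((\<lambda>c. [c]) ` C)))
                                  (subst_var n j [N] (series_of T))"
    using h(3-6,9,10) *[OF h(7)]
    by - (rule exI[of _ j], rule exI[of _ N], rule exI[of _ D], rule exI[of _ C], intro conjI)
  then show "first_type_ext n J T n' J' T'"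
    unfolding first_type_ext_def using is_pair_swap[OF h(1)] h(2) by (intro conjI)
qed

lemma illegal_ext_swap: "illegal_ext n J T n' J' T' \<Longrightarrow> illegal_ext n T J n' T' J'"
  using second_type_ext_swap[of 0 n J T n' J' T'] second_type_ext_swap[of 1 n J T n' J' T']
  by (auto simp: illegal_ext_def)

lemma legal_step_swap: "legal_step n T J n' T' J' \<Longrightarrow> legal_step n J T n' J' T'"
  unfolding legal_step_def extension_def permuted_def
  using first_type_ext_swap second_type_ext_swap illegal_ext_swap by metis

lemma primitive_pair_swap: "primitive_pair n T J \<Longrightarrow> primitive_pair n J T"
  unfolding primitive_pair_iff_fprim using is_pair_swap fprim_swap by blast

lemma primitive_second_type:
  assumes prim: "fprim {..<n} (enc ` T) (enc ` J)" and TJ: "T \<subseteq> vecs n" "J \<subseteq> vecs n"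
    and pair': "is_pair n' (permute_list \<pi> ` T'') (permute_list \<pi> ` J'')"
    and \<pi>: "\<pi> permutes {..<n'}" and ext: "second_type_ext 1 n T J n' T'' J''"
    and legal: "\<not> illegal_ext n T J n' T'' J''"
  shows "fprim {..<n'} (enc ` permute_list \<pi> ` T'') (enc ` permute_list \<pi> ` J'')"
proof -
  obtain j a where ja: "j < n" "length a \<ge> 2" "\<forall>c\<in>set a. c \<noteq> 0" "n' = n + length a - 1"
    and T'': "T'' = block_ext n j a (L_power a 1) T"
        and J'': "J'' = block_ext n j a (L_power a (1 - 1)) J"
    using second_type_ext_imp_block[OF ext] by blast
  interpret block n j a n' \<pi> using ja \<pi> by unfold_locales auto
  have eq: "enc ` permute_list \<pi> ` T'' = extend L (enc ` T)"
    "enc ` permute_list \<pi> ` J'' = stretch ` enc ` J"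
    unfolding T'' J'' using enc_block_ext[OF L_power_in_vecs[of a 1] TJ(1)]
      enc_block_ext[OF L_power_in_vecs[of a 0] TJ(2)]
    by (simp_all add: L_power_def block_vec_L_set block_vec_0 extend_zero)
  have "\<not> ({..<n} = {j} \<and> enc ` T = vectors {..<n} \<and> enc ` J = {0})"
  proof
    assume h: "{..<n} = {j} \<and> enc ` T = vectors {..<n} \<and> enc ` J = {0}"
    then have "card {..<n} = card {j}" by presburger
    then have n: "n = 1" by simp
    moreover have "T = vecs n" using h enc_image_eq_iff[OF TJ(1) order_refl] enc_vecs by simp
    moreover have "J = {replicate n 0}"
      using h enc_image_eq_iff[OF TJ(2), of "{replicate n 0}"] by simp
    ultimately show False using legal ext by (simp add: illegal_ext_def)
  qed
  moreover have "fpair {..<n'} (enc ` permute_list \<pi> ` T'') (enc ` permute_list \<pi> ` J'')"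
    using pair' is_pair_iff_fpair by blast
  ultimately show ?thesis unfolding eq by (intro fprim_extend[OF prim])
qed

lemma primitive_legal_step:
  assumes prim: "primitive_pair n T J" and pair': "is_pair n' T' J'"
    and step: "legal_step n T J n' T' J'"
  shows "primitive_pair n' T' J'"
proof -
  obtain \<pi> T'' J'' where \<pi>: "\<pi> permutes {..<n'}" and T': "T' = permute_list \<pi> ` T''"
    and J': "J' = permute_list \<pi> ` J''" and ext: "extension n T J n' T'' J''"
    and legal: "\<not> illegal_ext n T J n' T'' J''"
    using step unfolding legal_step_def permuted_def by blast
  have fp: "fprim {..<n} (enc ` T) (enc ` J)" and V: "T \<subseteq> vecs n" "J \<subseteq> vecs n"
    using prim by (auto simp: primitive_pair_iff_fprim is_pair_def)
  have "fprim {..<n'} (enc ` T') (enc ` J')"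
  proof (cases "first_type_ext n T J n' T'' J''")
    case True
    then obtain j N C D
        where h: "j < n" "N \<ge> 2" "n' = n" "C \<subseteq> {0..<N}" "D \<subseteq> {0..<N}" "0 \<in> C" "0 \<in> D"
      and ext: "T'' = block_ext n j [N] ((\<lambda>c. [c]) ` C) T" "J'' = block_ext n j [N] ((\<lambda>d. [d]) ` D) J"
      by (rule first_type_ext_imp_block)
    interpret block n j "[N]" n' \<pi> using h \<pi> by unfold_locales auto
    have sub: "(\<lambda>c. [c]) ` C \<subseteq> L_set [N]" "(\<lambda>c. [c]) ` D \<subseteq> L_set [N]"
      using h mem_L_set_iff by auto
    then have subV: "(\<lambda>c. [c]) ` C \<subseteq> vecs (length [N])" "(\<lambda>c. [c]) ` D \<subseteq> vecs (length [N])"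
      using L_set_in_vecs by blast+
    have eq: "enc ` T' = extend (block_vec ` (\<lambda>c. [c]) ` C) (enc ` T)"
      "enc ` J' = extend (block_vec ` (\<lambda>c. [c]) ` D) (enc ` J)"
      unfolding T' J' ext using enc_block_ext subV V by blast+
    have inL: "block_vec ` (\<lambda>c. [c]) ` C \<subseteq> L" "block_vec ` (\<lambda>c. [c]) ` D \<subseteq> L"
      using sub block_vec_L_set by blast+
    have "block_vec [0] = 0" using block_vec_0 by simp
    then have zero: "0 \<in> block_vec ` (\<lambda>c. [c]) ` C" "0 \<in> block_vec ` (\<lambda>c. [c]) ` D"
      using h by (metis image_eqI)+
    have "fibre = {inv \<pi> j}"
      using permutes_inverses[OF \<pi>] h \<pi>_less by (auto simp: le_less_Suc_eq) metis
    then show ?thesis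
      using fprim_extend_single[OF inL(1) zero(1) inL(2) zero(2) fp] pair'
      unfolding is_pair_iff_fpair eq by blast
  next
    case False
    then obtain \<delta> where \<delta>: "second_type_ext \<delta> n T J n' T'' J''"
      using ext by (auto simp: extension_def)
    then consider "\<delta> = 1" | "\<delta> = 0" by (auto simp: second_type_ext_def)
    then show ?thesis
    proof cases
      case 1
      then show ?thesis
        using primitive_second_type[OF fp V _ \<pi> _ legal] pair' \<delta> T' J' by simp
    next
      case 2
      then have "second_type_ext 1 n J T n' J'' T''" using second_type_ext_swap[OF \<delta>] by simp
      moreover have "\<not> illegal_ext n J T n' J'' T''" using legal illegal_ext_swap by blast
      ultimately have "fprim {..<n'} (enc ` J') (enc ` T')"
        using primitive_second_type[OF fprim_swap[OF fp] V(2,1) _ \<pi>] is_pair_swap[OF pair'] T' J'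
            by simp
      then show ?thesis by (rule fprim_swap)
    qed
  qed
  then show ?thesis using pair' primitive_pair_iff_fprim by blast
qed

text \<open>With \<open>T = {0}\<close> the other set is everything, and such a pair splits along
  any single coordinate.\<close>

lemma fprim_zero_left:
  assumes prim: "fprim I {0} J" and i: "i \<in> I"
  shows "I = {i}"
proof (rule ccontr)
  assume "I \<noteq> {i}"
  have "J = vectors I"
    using fpair_subset[OF fprim_fpair[OF prim]] fpair_obtain[OF fprim_fpair[OF prim]]
    by (metis add_0_left singletonD subsetI subset_antisym)
  then have "splits {i} {0} J" by (auto simp: splits_def intro: restr_in_vectors)
  then show False using prim i \<open>I \<noteq> {i}\<close> by (auto simp: fprim_def)
qed

text \<open>The component \<open>{0}\<close> is stretched and gets the trivial factor, so it remains
  \<open>{0}\<close>. This is the criterion by which reductions are seen to be legal.\<close>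

lemma illegal_ext_zero:
  assumes ill: "illegal_ext n T J n' T' J'"
  shows "T' = {replicate n' 0} \<or> J' = {replicate n' 0}"
proof -
  have *: "T' = {replicate n' 0}" if ext: "second_type_ext 0 n {replicate n 0} J n' T' J'"
      for n T' J n' J'
  proof -
    obtain j a where ja: "j < n" "length a \<ge> 2" "\<forall>c\<in>set a. c \<noteq> 0" "n' = n + length a - 1"
      and T': "T' = block_ext n j a (L_power a 0) {replicate n 0}"
      by (rule second_type_ext_imp_block[OF ext]) (rule that)
    interpret block n j a n' id using ja by unfold_locales (auto simp: permutes_id)
    have "enc ` permute_list id ` T' = enc ` {replicate n' 0}"
    proof -
      have "L_power a 0 = {replicate (length a) 0}" "{replicate n 0} \<subseteq> vecs n"
        by (simp_all add: L_power_def)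
      then have "enc ` permute_list id ` T' = extend {0} {0}"
        unfolding T' using enc_block_ext[of "L_power a 0" "{replicate n 0}"] L_power_in_vecs[of a 0]
        by (simp only: image_insert image_empty block_vec_0 enc_replicate_0)
      then show ?thesis
          by (simp only: extend_zero image_insert image_empty stretch_0 enc_replicate_0)
    qed
    moreover have "T' \<subseteq> vecs n'"
      unfolding T' using block_ext_in_vecs[OF j a L_power_in_vecs] n' by simp
    ultimately show ?thesis using enc_image_eq_iff[of T' n' "{replicate n' 0}"] by simp
  qed
  have "[0] = replicate 1 0" by simp
  then show ?thesis
    using ill * second_type_ext_swap[of 1 n T J n' T' J'] unfolding illegal_ext_def
    by (metis diff_self_eq_0)
qed

section \<open>Legal reductions and their termination\<close>

abbreviation level_sum :: "nat \<Rightarrow> nat list set \<Rightarrow> nat list set \<Rightarrow> nat" where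
  "level_sum n T J \<equiv> sum (split_level (enc ` T) (enc ` J)) {..<n}"

lemma L_set_single: "L_set [N] = (\<lambda>c. [c]) ` {0..<N}"
proof (intro equalityI subsetI)
  fix v assume v: "v \<in> L_set [N]"
  then obtain c where "v = [c]" using L_set_in_vecs[of "[N]"]
      by (auto simp: vecs_def length_Suc_conv)
  then show "v \<in> (\<lambda>c. [c]) ` {0..<N}" using v mem_L_set_iff[of v "[N]"] by simp
qed (auto simp: mem_L_set_iff)

text \<open>Being no unit vector makes \<open>s\<close> give real progress: either its support has
  at least two coordinates and the dimension drops, or its single exponent is at least 2. Sorting
  the support to the front lets the block start at coordinate 0.\<close>

lemma reduction_of_minimal:
  assumes prim: "primitive_pair n' T' J'" and ge2: "n' \<ge> 2"
    and min: "minimal_in (enc ` J') s" and nonunit: "\<And>i. s \<noteq> unit_vec i"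
  obtains n T J where "primitive_pair n T J" "legal_step n T J n' T' J'"
    "n < n' \<or> n = n' \<and> level_sum n T J < level_sum n' T' J'"
proof -
  have fp': "fprim {..<n'} (enc ` T') (enc ` J')" and V': "T' \<subseteq> vecs n'" "J' \<subseteq> vecs n'"
    and pair': "fpair {..<n'} (enc ` T') (enc ` J')"
    using prim by (auto simp: primitive_pair_iff_fprim is_pair_iff_fpair)
  have sV: "s \<in> vectors {..<n'}" "s \<noteq> 0"
    using min fpair_subset[OF pair'] by (auto simp: minimal_in_def)
  define S where "S = {i \<in> {..<n'}. s i > 0}"
  obtain \<sigma> where \<sigma>: "\<sigma> permutes {..<n'}" and \<sigma>S: "\<And>i. i < n' \<Longrightarrow> \<sigma> i < card S \<longleftrightarrow> i \<in> S"
    using permutes_subset_to_initial[of S n'] by (auto simp: S_def)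
  have "S \<noteq> {}" using vectors_nonzero_obtain[OF sV] by (auto simp: S_def)
  moreover have "finite S" by (simp add: S_def)
  ultimately have m: "card S \<ge> 1" by (simp add: Suc_leI card_gt_0_iff)
  have mle: "card S \<le> n'" using card_mono[of "{..<n'}" S] by (auto simp: S_def)
  \<comment> \<open>The \<open>card S\<close> coordinates of the block come from a single old
    coordinate.\<close>
  define n where "n = n' - card S + 1"
  define a where "a = map (\<lambda>k. s (inv \<sigma> k)) [0..<card S]"
  have len: "length a = card S" by (simp add: a_def)
  have inv: "inv \<sigma> (\<sigma> i) = i" "\<sigma> (inv \<sigma> i) = i" for i using permutes_inverses[OF \<sigma>] by auto
  have inv_S: "inv \<sigma> k \<in> S" if "k < card S" for k
    using \<sigma>S[of "inv \<sigma> k"] inv(2)[of k] permutes_in_image[OF \<sigma>, of "inv \<sigma> k"] that mle by auto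
  interpret block n 0 a n' \<sigma>
  proof
    show "\<forall>c\<in>set a. c \<noteq> 0" using inv_S by (auto simp: a_def S_def)
  qed (use m mle \<sigma> in \<open>auto simp: n_def a_def\<close>)
  have fibre: "fibre = S" using \<sigma>S len by (auto simp: S_def)
  have weight: "s i = (block_weight 0 a \<circ> \<sigma>) i" if "i \<in> fibre" for i
    using that inv(1)[of i] len by (auto simp: block_weight_def a_def)
  have s_fibre: "s \<in> vectors fibre" unfolding fibre using sV by (auto simp: vectors_def S_def)
  define F where "F = {b \<in> vectors {..<n}. stretch b \<in> enc ` T'}"
  define G where "G = {b \<in> vectors {..<n}. stretch b \<in> enc ` J'}"
  note ext = extend_of_minimal[OF pair' min s_fibre weight, folded F_def G_def]
  define T J where "T = dec n ` F" and "J = dec n ` G"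
  have enc: "enc ` T = F" "enc ` J = G"
    unfolding T_def J_def by (rule enc_image_dec; auto simp: F_def G_def)+
  have V: "T \<subseteq> vecs n" "J \<subseteq> vecs n" by (auto simp: T_def J_def)
  have pair: "is_pair n T J"
    using ext(3) V by (simp add: is_pair_iff_fpair enc n_def)
  have fp: "fprim {..<n} (enc ` T) (enc ` J)"
    using fprim_of_extend[of F G] fp' ext unfolding enc by simp
  define T'' where "T'' = block_ext n 0 a (L_set a) T"
  define J'' where "J'' = block_ext n 0 a {replicate (length a) 0} J"
  have V'': "T'' \<subseteq> vecs n'" "J'' \<subseteq> vecs n'"
    unfolding T''_def J''_def using block_ext_in_vecs[OF j a] L_set_in_vecs V n'
    by simp_all
  have e: "enc ` permute_list \<sigma> ` T'' = enc ` T'" "enc ` permute_list \<sigma> ` J'' = enc ` J'"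
    unfolding T''_def J''_def using enc_block_ext[OF L_set_in_vecs V(1)]
      enc_block_ext[of "{replicate (length a) 0}", OF _ V(2)] ext(1,2)
    by (simp_all add: enc block_vec_L_set block_vec_0 extend_zero)
  have "permute_list \<sigma> ` T'' \<subseteq> vecs n'" "permute_list \<sigma> ` J'' \<subseteq> vecs n'" using V'' by auto
  then have perm: "T' = permute_list \<sigma> ` T''" "J' = permute_list \<sigma> ` J''"
    using enc_image_eq_iff V' e by metis+
  have "replicate (length a) 0 \<in> L_set a"
    using mem_L_set_iff[of "replicate (length a) 0" a] a a_pos by (auto intro!: exI[of _ 0])
  then have series:
    "series_of T'' = ms_mult n' (in_vars n' 0 (length a) (series_of (L_set a))) (subst_var n 0 a (series_of T))"
    "series_of J'' = ms_mult n' (in_vars n' 0 (length a) (series_of {replicate (length a) 0})) (subst_var n 0 a (series_of J))"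
    unfolding T''_def J''_def using series_of_block_ext V by simp_all
  have "\<not> illegal_ext n T J n' T'' J''"
  proof
    assume "illegal_ext n T J n' T'' J''"
    then have "T'' = {replicate n' 0} \<or> J'' = {replicate n' 0}" by (rule illegal_ext_zero)
    moreover have "enc (permute_list \<sigma> (replicate n' 0)) = 0"
      using enc_permute_list[OF \<sigma>, of "replicate n' 0"] by (simp add: fun_eq_iff)
    ultimately have "enc ` T' = {0} \<or> enc ` J' = {0}" unfolding perm by auto
    moreover have "0 \<in> {..<n'}" using ge2 by simp
    ultimately have "{..<n'} = {0}" using fprim_zero_left fp' fprim_swap[OF fp'] by metis
    then have "card {..<n'} = card {0::nat}" by presburger
    then show False using ge2 by simp
  qed
  moreover have "extension n T J n' T'' J'' \<and>
    (n < n' \<or> n = n' \<and> level_sum n T J < level_sum n' T' J')"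
  proof (cases "card S = 1")
    case False
    then have "second_type_ext 1 n T J n' T'' J''"
      unfolding second_type_ext_iff_series using pair j m len n' a_pos series
      by (intro conjI exI[of _ 0] exI[of _ a]) (auto simp: L_power_def)
    then show ?thesis using False m mle by (auto simp: extension_def n_def)
  next
    case True
    then obtain k where k: "S = {k}" by (auto simp: card_1_singleton_iff)
    define N where "N = s k"
    have nn: "n = n'" using True mle by (simp add: n_def)
    have kS: "k \<in> S" using k by simp
    have "inv \<sigma> 0 = k" using inv_S[of 0] True k by auto
    then have aN: "a = [N]" using True by (simp add: a_def N_def)
    have kN: "(block_weight 0 a \<circ> \<sigma>) k = N" unfolding N_def
      by (rule weight[symmetric]) (use kS fibre in blast)
    have "N \<noteq> 0" using kS by (simp add: N_def S_def)
    moreover have "N \<noteq> 1"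
    proof
      assume "N = 1"
      then have "s = unit_vec k"
        using vectorsD[OF s_fibre[unfolded fibre k]] by (auto simp: unit_vec_def N_def fun_eq_iff)
      then show False using nonunit by blast
    qed
    ultimately have N: "N \<ge> 2" by simp
    \<comment> \<open>\<open>L_set [N]\<close> is the whole interval \<open>{0..<N}\<close>, so the
      step is of first type with \<open>C = {0..<N}\<close> and \<open>D = {0}\<close>.\<close>
    have uniq: "\<exists>!p. p \<in> {0..<N} \<times> {0} \<and> fst p + snd p = i" if "i \<in> {0..<N}" for i
      using that by (intro ex1I[of _ "(i, 0)"]) auto
    have sum: "{c + d | c d. c \<in> {0..<N} \<and> d \<in> {0}} = {0..<N}" by auto
    have series1:
      "series_of T'' = ms_mult n' (in_vars n' 0 1 (series_of ((\<lambda>c. [c]) ` {0..<N}))) (subst_var n 0 [N] (series_of T))"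
      "series_of J'' = ms_mult n' (in_vars n' 0 1 (series_of ((\<lambda>d. [d]) ` {0}))) (subst_var n 0 [N] (series_of J))"
      using series by (simp_all add: aN L_set_single)
    have "first_type_ext n T J n' T'' J''"
      unfolding first_type_ext_def
      by (rule conjI[OF pair conjI[OF nn[symmetric]]], rule exI[of _ 0], rule exI[of _ N],
          rule exI[of _ "{0..<N}"], rule exI[of _ "{0}"], intro conjI ballI j N uniq sum series1)
        (use N in auto)
    moreover have "level_sum n T J < level_sum n' T' J'"
    proof -
      have "fibre = {k}" using fibre k by simp
      moreover have "{..<n'} \<noteq> {k}" using ge2 by (auto dest!: arg_cong[of _ _ card])
      ultimately have "sum (split_level F G) {..<n} <
          sum (split_level (extend L F) (stretch ` G)) {..<n'}"
        using sum_split_level_less[of k F G] kN N fp' ext by simp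
      then show ?thesis by (simp only: enc ext(1,2))
    qed
    ultimately show ?thesis using nn by (simp add: extension_def)
  qed
  ultimately show ?thesis
    using that[of n T J] pair fp \<sigma> perm
        unfolding primitive_pair_iff_fprim legal_step_def permuted_def
    by blast
qed

lemma level_sum_swap: "level_sum n T J = level_sum n J T"
  by (simp add: split_level_swap)

lemma primitive_reduction:
  assumes prim: "primitive_pair n' T' J'" and n': "n' \<ge> 2"
  obtains n T J where "primitive_pair n T J" "legal_step n T J n' T' J'"
    "n < n' \<or> n = n' \<and> level_sum n T J < level_sum n' T' J'"
proof -
  have fp: "fprim {..<n'} (enc ` T') (enc ` J')" using prim primitive_pair_iff_fprim by blast
  have "0 \<in> {..<n'}" "1 \<in> {..<n'}" using n' by auto
  then have "{..<n'} \<noteq> {0}" by (metis singletonD zero_neq_one)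
  then obtain s where s: "minimal_in (enc ` J') s \<or> minimal_in (enc ` T') s" "\<And>i. s \<noteq> unit_vec i"
    using nonunit_minimal[OF _ fp \<open>0 \<in> {..<n'}\<close>] by blast
  from s(1) show ?thesis
  proof
    assume "minimal_in (enc ` J') s"
    then show ?thesis using reduction_of_minimal[OF prim n' _ s(2)] that by blast
  next
    assume "minimal_in (enc ` T') s"
    then obtain n J T where "primitive_pair n J T" "legal_step n J T n' J' T'"
      "n < n' \<or> n = n' \<and> level_sum n J T < level_sum n' J' T'"
      using reduction_of_minimal[OF primitive_pair_swap[OF prim] n' _ s(2)] by blast
    then show ?thesis
      using that[of n T J] primitive_pair_swap legal_step_swap level_sum_swap by metis
  qed
qed

section \<open>Legal chains as an inductive closure\<close>

inductive legally_generated :: "nat \<Rightarrow> nat list set \<Rightarrow> nat list set \<Rightarrow> bool" where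
  base: "is_pair 1 T J \<Longrightarrow> legally_generated 1 T J"
| step: "legally_generated n T J \<Longrightarrow> is_pair n' T' J' \<Longrightarrow> legal_step n T J n' T' J' \<Longrightarrow>
    legally_generated n' T' J'"

text \<open>Lexicographic induction: second type reductions lower the dimension, whatever happens to
  the level sum, while first type ones keep the dimension and lower the level sum.\<close>

lemma primitive_imp_generated: "primitive_pair n T J \<Longrightarrow> legally_generated n T J"
proof (induction "(n, level_sum n T J)" arbitrary: n T J rule: wf_induct_rule[OF wf_lex_prod[OF wf_less_than wf_less_than]])
  case 1
  note prim = \<open>primitive_pair n T J\<close>
  then have pair: "is_pair n T J" by (simp add: primitive_pair_def)
  show ?case
  proof (cases "n = 1")
    case True
    then show ?thesis using pair base by simp
  next
    case False
    then have "n \<ge> 2" using pair by (auto simp: is_pair_def)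
    then obtain m U V where mUV: "primitive_pair m U V" "legal_step m U V n T J"
      "m < n \<or> m = n \<and> level_sum m U V < level_sum n T J"
      using primitive_reduction[OF prim] by blast
    then have "legally_generated m U V" using 1 by auto
    then show ?thesis using step pair mUV by blast
  qed
qed

text \<open>A product has dimension at least 2, as each factor has at least one coordinate.\<close>

lemma primitive_pair_1: "is_pair 1 T J \<Longrightarrow> primitive_pair 1 T J"
  by (auto simp: primitive_pair_def is_pair_def)

lemma generated_imp_primitive: "legally_generated n T J \<Longrightarrow> primitive_pair n T J"
  by (induction rule: legally_generated.induct) (blast intro: primitive_pair_1 primitive_legal_step)+

definition legal_chain ::
  "nat \<Rightarrow> (nat \<Rightarrow> nat) \<Rightarrow> (nat \<Rightarrow> nat list set) \<Rightarrow> (nat \<Rightarrow> nat list set) \<Rightarrow> bool" where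
  "legal_chain k d Ts Js \<longleftrightarrow> (\<forall>i\<le>k. is_pair (d i) (Ts i) (Js i)) \<and> d 0 = 1 \<and>
     (\<forall>i\<in>{1..k}. legal_step (d (i - 1)) (Ts (i - 1)) (Js (i - 1)) (d i) (Ts i) (Js i))"

lemma legally_generated_chain:
  "legally_generated n T J \<Longrightarrow>
    \<exists>k d Ts Js. legal_chain k d Ts Js \<and> d k = n \<and> Ts k = T \<and> Js k = J"
proof (induction rule: legally_generated.induct)
  case (base T J)
  then have "legal_chain 0 (\<lambda>_. 1) (\<lambda>_. T) (\<lambda>_. J)" by (simp add: legal_chain_def)
  then show ?case by fastforce
next
  case (step n T J n' T' J')
  then obtain k d Ts Js where c: "legal_chain k d Ts Js" "d k = n" "Ts k = T" "Js k = J"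
    by blast
  then have "legal_chain (Suc k) (d(Suc k := n')) (Ts(Suc k := T')) (Js(Suc k := J'))"
    using step.hyps by (auto simp: legal_chain_def le_Suc_eq)
  moreover have "(d(Suc k := n')) (Suc k) = n'" "(Ts(Suc k := T')) (Suc k) = T'"
    "(Js(Suc k := J')) (Suc k) = J'" by simp_all
  ultimately show ?case by blast
qed

lemma legal_chain_generated:
  assumes "legal_chain k d Ts Js" "i \<le> k"
  shows "legally_generated (d i) (Ts i) (Js i)"
  using assms(2)
proof (induction i)
  case 0
  have "is_pair 1 (Ts 0) (Js 0)" "d 0 = 1" using assms(1) by (auto simp: legal_chain_def)
  then show ?case using legally_generated.base by metis
next
  case (Suc i)
  have "Suc i \<in> {1..k}" using Suc.prems by simp
  then have "legal_step (d (Suc i - 1)) (Ts (Suc i - 1)) (Js (Suc i - 1)) (d (Suc i)) (Ts (Suc i)) (Js (Suc i))"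
    "is_pair (d (Suc i)) (Ts (Suc i)) (Js (Suc i))"
    using assms(1) Suc.prems unfolding legal_chain_def by blast+
  then show ?case using Suc legally_generated.step by simp
qed

theorem theorem1p1:
  fixes n :: nat and T J :: "nat list set"
  assumes "is_pair n T J"
  shows "primitive_pair n T J \<longleftrightarrow>
    (\<exists>(k :: nat) (d :: nat \<Rightarrow> nat) (Ts :: nat \<Rightarrow> nat list set) (Js :: nat \<Rightarrow> nat list set).
       (\<forall>i\<le>k. is_pair (d i) (Ts i) (Js i)) \<and>
       d 0 = 1 \<and>
       d k = n \<and> Ts k = T \<and> Js k = J \<and>
       (\<forall>i\<in>{1..k}. legal_step (d (i - 1)) (Ts (i - 1)) (Js (i - 1)) (d i) (Ts i) (Js i)))"
proof -
  have "primitive_pair n T J \<longleftrightarrow>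
    (\<exists>k d Ts Js. legal_chain k d Ts Js \<and> d k = n \<and> Ts k = T \<and> Js k = J)"
    using primitive_imp_generated generated_imp_primitive legally_generated_chain
      legal_chain_generated[OF _ order_refl] by metis
  then show ?thesis by (simp add: legal_chain_def conj_ac)
qed
end
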